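(* Let $m>1$, $0\le u_0\in(L^1\cap L^\infty)(\mathbb{R}^N)$, and let $-\mathfrak{L}$ be an operator as in the context. Let $u$ be a weak dual solution of $\partial_tu+(-\mathfrak{L})[u^m]=0$ with initial data $u_0$. (a) Suppose that the Green function assumption holds for $A=-\mathfrak{L}$ and that one of the conditions $(\mathrm G_1)$, $(\mathrm G_1')$, $(\mathrm G_2)$ listed in the context holds. Then, for a.e. $\tau_*>0$ and all Lebesgue points $x_0\in\mathbb{R}^N$, $$u^m(x_0,\tau_* )\le C(m)\frac1{\tau_*}\int_{\mathbb{R}^N}u(x,\tau_* )\,\mathbb{G}_{-\mathfrak{L}}^{x_0}(x)\,dx,\qquad C(m):=2^{\frac{m}{m-1}}.$$ (b) Suppose that the Green function assumption holds for $A=I-\mathfrak{L}$ and that condition $(\mathrm G_3)$ listed in the context holds. Then, for a.e. $\tau_*>0$ such that $$\lambda:=\|u(\cdot,\tau_* )\|_{L^\infty(\mathbb{R}^N)}^{m-1}>\frac{1}{(m-1)\tau_*},$$ and all Lebesgue points $x_0\in\mathbb{R}^N$, $$u^m(x_0,\tau_* )\le C(m)\,\lambda\int_{\mathbb{R}^N}u(x,\tau_* )\,\mathbb{G}_{I-\mathfrak{L}}^{x_0}(x)\,dx,\qquad C(m):=2(1+m)^{\frac{m}{m-1}}.$$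
   Context: Throughout $N\ge 3$. Operator. $-\mathfrak{L}$ is a linear, symmetric, nonnegative operator which is densely defined, $\mathfrak m$-accretive and Dirichlet in $L^1(\mathbb{R}^N)$: writing $A=-\mathfrak{L}$ with domain $D(A)\subset L^1(\mathbb{R}^N)$, $D(A)$ is dense in $L^1$; $\|u\|_{L^1}\le\|u+\lambda A[u]\|_{L^1}$ for all $u\in D(A)$, $\lambda>0$; the range of $I+\lambda A$ is $L^1(\mathbb{R}^N)$ for all $\lambda>0$; and if $f\in L^1$, $a\le f\le b$ a.e. ($a,b\in\mathbb{R}$), then $a\le(I+\lambda A)^{-1}f\le b$ a.e. Green function assumption for an operator $A$: there is a function $\mathbb{G}_A^{x_0}\in L^1_{\rm loc}(\mathbb{R}^N)$ (for each $x_0$) with $0\le\mathbb{G}_A^{x_0}=\mathbb{G}_A^0(\cdot-x_0)=\mathbb{G}_A^0(x_0-\cdot)$ a.e. and $A[\mathbb{G}_A^{x_0}]=\delta_{x_0}$ in $\mathcal D'(\mathbb{R}^N)$. Then $A^{-1}[f](y):=\int_{\mathbb{R}^N}\mathbb{G}_A^0(x-y)f(x)\,dx$ whenever the integral converges. One has $\|\mathbb{G}^0_{I-\mathfrak{L}}\|_{L^1(\mathbb{R}^N)}\le1$. Conditions (constants positive and independent of $x_0$): $(\mathrm G_1)$: for some $x_0$ and some $\alpha\in(0,2]$, for all $R>0$: $\int_{B_R(x_0)}\mathbb{G}_{-\mathfrak{L}}^{x_0}\le K_1R^\alpha$ and $\mathbb{G}_{-\mathfrak{L}}^{x_0}(x)\le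 K_2R^{-(N-\alpha)}$ for a.e. $x\in\mathbb{R}^N\setminus B_R(x_0)$. $(\mathrm G_1')$: the same with the second bound replaced by $\mathbb{G}_{-\mathfrak{L}}^{x_0}(x)\le\max\{K_3,K_2R^{-(N-\alpha)}\}$. $(\mathrm G_2)$: $\|\mathbb{G}_{-\mathfrak{L}}^{x_0}\|_{L^1(\mathbb{R}^N)}=\|\mathbb{G}_{-\mathfrak{L}}^{0}\|_{L^1(\mathbb{R}^N)}\le C_1<\infty$. $(\mathrm G_3)$: for some $p\in(1,\infty)$, $\|\mathbb{G}_{I-\mathfrak{L}}^{x_0}\|_{L^p(\mathbb{R}^N)}=\|\mathbb{G}_{I-\mathfrak{L}}^{0}\|_{L^p(\mathbb{R}^N)}\le C_p<\infty$. Weak dual solution in $\mathbb{R}^N\times(0,T)$ with $u(\cdot,0)=u_0$: a nonnegative measurable $u$ such that (i) $u\in C([0,T];L^1(\mathbb{R}^N))$ and $u^m\in L^1((0,T);L^1_{\rm loc}(\mathbb{R}^N))$; (ii) for a.e. $0<\tau_1\le\tau_2\le T$ and all $\psi\in C^1_{\rm c}([\tau_1,\tau_2];L^\infty_{\rm c}(\mathbb{R}^N))$ ($L_{\rm c}^\infty$: bounded functions with compact support), in part (a) $$\int_{\tau_1}^{\tau_2}\!\!\int_{\mathbb{R}^N}\big((-\mathfrak{L})^{-1}[u]\partial_t\psi-u^m\psi\big)dx\,dt=\int_{\mathbb{R}^N}(-\mathfrak{L})^{-1}[u(\cdot,\tau_2)]\psi(\cdot,\tau_2)dx-\int_{\mathbb{R}^N}(-\mathfrak{L})^{-1}[u(\cdot,\tau_1)]\psi(\cdot,\tau_1)dx,$$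 and in part (b) (for the equivalent equation $\partial_tu+(I-\mathfrak{L})[u^m]=u^m$) $$\int_{\tau_1}^{\tau_2}\!\!\int_{\mathbb{R}^N}\big((I-\mathfrak{L})^{-1}[u]\partial_t\psi-u^m\psi+u^m(I-\mathfrak{L})^{-1}[\psi]\big)dx\,dt=\int_{\mathbb{R}^N}(I-\mathfrak{L})^{-1}[u(\cdot,\tau_2)]\psi(\cdot,\tau_2)dx-\int_{\mathbb{R}^N}(I-\mathfrak{L})^{-1}[u(\cdot,\tau_1)]\psi(\cdot,\tau_1)dx;$$ (iii) $u(\cdot,0)=u_0$ a.e. Here $u$ is a weak dual solution for every $T>0$. Standing assumption: the comparison principle ($u_0\le v_0$ a.e. implies $u\le v$ a.e.) and $L^p$-decay ($\|u(\cdot,\tau_2)\|_{L^r}\le\|u(\cdot,\tau_1)\|_{L^r}$ for $r\in[1,\infty]$ and a.e. $0\le\tau_1\le\tau_2$) hold for solutions of the equation. A version of the bounded solution $u\in L^\infty\cap C([0,T];L^1)$ is fixed, defined by limits of space-time averages, so that pointwise values at Lebesgue points make sense. *)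

theory Defs
  imports "HOL-Probability.Probability"
begin

text \<open>
  Elements of Lebesgue spaces are represented by Borel functions, and every identity between them
  is stated almost everywhere. A function on space-time is curried with time first,
  \<open>u t x\<close>; the measure on space-time is \<open>lborel\<close> on \<open>real \<times> 'a\<close>.
\<close>

section \<open>Lebesgue spaces and test functions\<close>

definition lnorm :: "ennreal \<Rightarrow> ('a::euclidean_space \<Rightarrow> real) \<Rightarrow> ennreal" where
  "lnorm r f =
    (if r = \<infinity> then esssup lborel (\<lambda>x. ennreal \<bar>f x\<bar>)
     else let I = (\<integral>\<^sup>+x. ennreal (\<bar>f x\<bar> powr enn2real r) \<partial>lborel)
          in if I = \<infinity> then \<infinity> else ennreal (enn2real I powr (1 / enn2real r)))"

definition L1_loc :: "('a::euclidean_space \<Rightarrow> real) \<Rightarrow> bool" where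
  "L1_loc f \<longleftrightarrow> f \<in> borel_measurable borel \<and> (\<forall>K. compact K \<longrightarrow> set_integrable lborel K f)"

primrec C_k :: "nat \<Rightarrow> ('a::euclidean_space \<Rightarrow> real) \<Rightarrow> bool" where
  "C_k 0 f \<longleftrightarrow> continuous_on UNIV f"
| "C_k (Suc k) f \<longleftrightarrow>
    (\<exists>f'. (\<forall>x. (f has_derivative f' x) (at x)) \<and> (\<forall>b\<in>Basis. C_k k (\<lambda>x. f' x b)))"

definition test_function :: "('a::euclidean_space \<Rightarrow> real) \<Rightarrow> bool" where
  "test_function \<phi> \<longleftrightarrow> (\<forall>k. C_k k \<phi>) \<and> (\<exists>K. compact K \<and> (\<forall>x. x \<notin> K \<longrightarrow> \<phi> x = 0))"

text \<open>
  \<open>\<psi>\<close> is in \<open>C\<^sup>1\<^sub>c([a,b]; L\<^sup>\<infinity>\<^sub>c)\<close> with time derivative \<open>\<psi>'\<close>: the difference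
  quotients and the continuity of \<open>\<psi>'\<close> are taken in the norm of \<open>L\<^sup>\<infinity>\<close>, and the compact support is
  that of \<open>\<psi>\<close> as a function on \<open>[a,b] \<times> \<real>\<^sup>N\<close>.
\<close>

definition test_curve ::
  "real \<Rightarrow> real \<Rightarrow> (real \<Rightarrow> 'a::euclidean_space \<Rightarrow> real) \<Rightarrow> (real \<Rightarrow> 'a \<Rightarrow> real) \<Rightarrow> bool" where
  "test_curve a b \<psi> \<psi>' \<longleftrightarrow>
    set_borel_measurable borel ({a..b} \<times> UNIV) (\<lambda>(t, x). \<psi> t x) \<and>
    set_borel_measurable borel ({a..b} \<times> UNIV) (\<lambda>(t, x). \<psi>' t x) \<and>
    (\<exists>K. compact K \<and> (\<forall>t\<in>{a..b}. \<forall>x. x \<notin> K \<longrightarrow> \<psi> t x = 0 \<and> \<psi>' t x = 0)) \<and>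
    (\<forall>t\<in>{a..b}. lnorm \<infinity> (\<psi> t) < \<infinity> \<and> lnorm \<infinity> (\<psi>' t) < \<infinity>) \<and>
    (\<forall>t\<in>{a..b}. ((\<lambda>s. lnorm \<infinity> (\<lambda>x. (\<psi> s x - \<psi> t x) / (s - t) - \<psi>' t x)) \<longlongrightarrow> 0)
                  (at t within {a..b})) \<and>
    (\<forall>t\<in>{a..b}. ((\<lambda>s. lnorm \<infinity> (\<lambda>x. \<psi>' s x - \<psi>' t x)) \<longlongrightarrow> 0) (at t within {a..b}))"

section \<open>The operator\<close>

text \<open>
  An operator in \<open>L\<^sup>1\<close> is a map \<open>A\<close> on functions together with its domain \<open>D\<close>. The pairings in the
  conditions of symmetry and nonnegativity are those between \<open>L\<^sup>1\<close> and \<open>L\<^sup>\<infinity>\<close>.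
\<close>

definition L1_operator ::
  "('a::euclidean_space \<Rightarrow> real) set \<Rightarrow> (('a \<Rightarrow> real) \<Rightarrow> 'a \<Rightarrow> real) \<Rightarrow> bool" where
  "L1_operator D A \<longleftrightarrow>
    (\<forall>f\<in>D. integrable lborel f \<and> integrable lborel (A f)) \<and>
    (\<forall>f\<in>D. \<forall>g. integrable lborel g \<and> (AE x in lborel. g x = f x) \<longrightarrow>
       g \<in> D \<and> (AE x in lborel. A g x = A f x))"

definition linear_op ::
  "('a::euclidean_space \<Rightarrow> real) set \<Rightarrow> (('a \<Rightarrow> real) \<Rightarrow> 'a \<Rightarrow> real) \<Rightarrow> bool" where
  "linear_op D A \<longleftrightarrow>
    (\<forall>f\<in>D. \<forall>g\<in>D. \<forall>c d :: real. (\<lambda>x. c * f x + d * g x) \<in> D \<and>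
       (AE x in lborel. A (\<lambda>x. c * f x + d * g x) x = c * A f x + d * A g x))"

definition symmetric_op ::
  "('a::euclidean_space \<Rightarrow> real) set \<Rightarrow> (('a \<Rightarrow> real) \<Rightarrow> 'a \<Rightarrow> real) \<Rightarrow> bool" where
  "symmetric_op D A \<longleftrightarrow>
    (\<forall>f\<in>D. \<forall>g\<in>D. lnorm \<infinity> f < \<infinity> \<and> lnorm \<infinity> g < \<infinity> \<longrightarrow>
       (\<integral>x. A f x * g x \<partial>lborel) = (\<integral>x. f x * A g x \<partial>lborel))"

definition nonnegative_op ::
  "('a::euclidean_space \<Rightarrow> real) set \<Rightarrow> (('a \<Rightarrow> real) \<Rightarrow> 'a \<Rightarrow> real) \<Rightarrow> bool" where
  "nonnegative_op D A \<longleftrightarrow>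
    (\<forall>f\<in>D. lnorm \<infinity> f < \<infinity> \<longrightarrow> 0 \<le> (\<integral>x. A f x * f x \<partial>lborel))"

definition densely_defined_op :: "('a::euclidean_space \<Rightarrow> real) set \<Rightarrow> bool" where
  "densely_defined_op D \<longleftrightarrow>
    (\<forall>f. integrable lborel f \<longrightarrow> (\<forall>\<epsilon>>0. \<exists>g\<in>D. (\<integral>x. \<bar>f x - g x\<bar> \<partial>lborel) < \<epsilon>))"

definition m_accretive_op ::
  "('a::euclidean_space \<Rightarrow> real) set \<Rightarrow> (('a \<Rightarrow> real) \<Rightarrow> 'a \<Rightarrow> real) \<Rightarrow> bool" where
  "m_accretive_op D A \<longleftrightarrow>
    (\<forall>\<mu>>0. \<forall>f\<in>D. (\<integral>x. \<bar>f x\<bar> \<partial>lborel) \<le> (\<integral>x. \<bar>f x + \<mu> * A f x\<bar> \<partial>lborel)) \<and>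
    (\<forall>\<mu>>0. \<forall>g. integrable lborel g \<longrightarrow> (\<exists>f\<in>D. AE x in lborel. f x + \<mu> * A f x = g x))"

text \<open>In the next definition \<open>f\<close> is \<open>(I + \<mu> A)\<^sup>-\<^sup>1 g\<close>.\<close>

definition dirichlet_op ::
  "('a::euclidean_space \<Rightarrow> real) set \<Rightarrow> (('a \<Rightarrow> real) \<Rightarrow> 'a \<Rightarrow> real) \<Rightarrow> bool" where
  "dirichlet_op D A \<longleftrightarrow>
    (\<forall>\<mu>>0. \<forall>g a b. integrable lborel g \<and> (AE x in lborel. a \<le> g x \<and> g x \<le> b) \<longrightarrow>
       (\<forall>f\<in>D. (AE x in lborel. f x + \<mu> * A f x = g x) \<longrightarrow>
          (AE x in lborel. a \<le> f x \<and> f x \<le> b)))"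

definition admissible_operator ::
  "('a::euclidean_space \<Rightarrow> real) set \<Rightarrow> (('a \<Rightarrow> real) \<Rightarrow> 'a \<Rightarrow> real) \<Rightarrow> bool" where
  "admissible_operator D A \<longleftrightarrow>
    L1_operator D A \<and> linear_op D A \<and> symmetric_op D A \<and> nonnegative_op D A \<and>
    densely_defined_op D \<and> m_accretive_op D A \<and> dirichlet_op D A"

section \<open>Green functions\<close>

text \<open>
  \<open>G x0\<close> is the Green function with pole \<open>x0\<close>. The equation \<open>A[G x0] = \<delta>\<^bsub>x0\<^esub>\<close> in the sense of
  distributions means that \<open>G x0\<close> paired with \<open>A \<phi>\<close> gives \<open>\<phi> x0\<close> (\<open>A\<close> is symmetric); for the
  pairing to make sense, \<open>\<phi>\<close> has to be in the domain and the integral has to converge.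
\<close>

definition green_function ::
  "('a::euclidean_space \<Rightarrow> real) set \<Rightarrow> (('a \<Rightarrow> real) \<Rightarrow> 'a \<Rightarrow> real) \<Rightarrow> ('a \<Rightarrow> 'a \<Rightarrow> real) \<Rightarrow> bool" where
  "green_function D A G \<longleftrightarrow>
    (\<forall>x0. L1_loc (G x0) \<and>
       (AE x in lborel. 0 \<le> G x0 x \<and> G x0 x = G 0 (x - x0) \<and> G x0 x = G 0 (x0 - x)) \<and>
       (\<forall>\<phi>. test_function \<phi> \<longrightarrow>
          \<phi> \<in> D \<and> integrable lborel (\<lambda>x. G x0 x * A \<phi> x) \<and>
          (\<integral>x. G x0 x * A \<phi> x \<partial>lborel) = \<phi> x0))"

definition green_inv :: "('a::euclidean_space \<Rightarrow> 'a \<Rightarrow> real) \<Rightarrow> ('a \<Rightarrow> real) \<Rightarrow> 'a \<Rightarrow> real" where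
  "green_inv G f y = (\<integral>x. G 0 (x - y) * f x \<partial>lborel)"

definition green_G1 :: "('a::euclidean_space \<Rightarrow> 'a \<Rightarrow> real) \<Rightarrow> bool" where
  "green_G1 G \<longleftrightarrow>
    (\<exists>x0::'a. \<exists>\<alpha> K1 K2. 0 < \<alpha> \<and> \<alpha> \<le> 2 \<and> 0 < K1 \<and> 0 < K2 \<and>
       (\<forall>R>0. (LINT x:ball x0 R|lborel. G x0 x) \<le> K1 * R powr \<alpha> \<and>
              (AE x in lborel. x \<notin> ball x0 R \<longrightarrow> G x0 x \<le> K2 * R powr - (real DIM('a) - \<alpha>))))"

definition green_G1' :: "('a::euclidean_space \<Rightarrow> 'a \<Rightarrow> real) \<Rightarrow> bool" where
  "green_G1' G \<longleftrightarrow>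
    (\<exists>x0::'a. \<exists>\<alpha> K1 K2 K3. 0 < \<alpha> \<and> \<alpha> \<le> 2 \<and> 0 < K1 \<and> 0 < K2 \<and> 0 < K3 \<and>
       (\<forall>R>0. (LINT x:ball x0 R|lborel. G x0 x) \<le> K1 * R powr \<alpha> \<and>
              (AE x in lborel. x \<notin> ball x0 R \<longrightarrow>
                 G x0 x \<le> max K3 (K2 * R powr - (real DIM('a) - \<alpha>)))))"

definition green_G2 :: "('a::euclidean_space \<Rightarrow> 'a \<Rightarrow> real) \<Rightarrow> bool" where
  "green_G2 G \<longleftrightarrow>
    (\<exists>C>0. \<forall>x0. lnorm 1 (G x0) = lnorm 1 (G 0) \<and> lnorm 1 (G 0) \<le> ennreal C)"

definition green_G3 :: "('a::euclidean_space \<Rightarrow> 'a \<Rightarrow> real) \<Rightarrow> bool" where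
  "green_G3 G \<longleftrightarrow>
    (\<exists>p>1. \<exists>C>0. \<forall>x0. lnorm (ennreal p) (G x0) = lnorm (ennreal p) (G 0) \<and>
       lnorm (ennreal p) (G 0) \<le> ennreal C)"

section \<open>Weak dual solutions\<close>

definition initial_datum :: "('a::euclidean_space \<Rightarrow> real) \<Rightarrow> bool" where
  "initial_datum u0 \<longleftrightarrow>
    (AE x in lborel. 0 \<le> u0 x) \<and> integrable lborel u0 \<and> lnorm \<infinity> u0 < \<infinity>"

definition solution_class ::
  "real \<Rightarrow> real \<Rightarrow> ('a::euclidean_space \<Rightarrow> real) \<Rightarrow> (real \<Rightarrow> 'a \<Rightarrow> real) \<Rightarrow> bool" where
  "solution_class m T u0 u \<longleftrightarrow>
    set_borel_measurable borel ({0..T} \<times> UNIV) (\<lambda>(t, x). u t x) \<and>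
    (\<forall>t\<in>{0..T}. AE x in lborel. 0 \<le> u t x) \<and>
    (\<forall>t\<in>{0..T}. integrable lborel (u t)) \<and>
    (\<forall>t\<in>{0..T}. ((\<lambda>s. \<integral>x. \<bar>u s x - u t x\<bar> \<partial>lborel) \<longlongrightarrow> 0) (at t within {0..T})) \<and>
    (\<forall>K. compact K \<longrightarrow> set_integrable lborel ({0<..<T} \<times> K) (\<lambda>(t, x). u t x powr m)) \<and>
    (AE x in lborel. u 0 x = u0 x)"

text \<open>
  The two notions below belong to the two ways of writing the same equation, with \<open>G\<close> the Green
  function of \<open>-\<LL>\<close> in the first and of \<open>I - \<LL>\<close> in the second. Convergence of the integrals in the
  identity is part of the identity; it has to be spelled out because the Bochner integral of a
  function that is not integrable is \<open>0\<close>.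
\<close>

definition weak_dual_solution_on ::
  "('a::euclidean_space \<Rightarrow> 'a \<Rightarrow> real) \<Rightarrow> real \<Rightarrow> real \<Rightarrow> ('a \<Rightarrow> real) \<Rightarrow> (real \<Rightarrow> 'a \<Rightarrow> real) \<Rightarrow> bool"
where
  "weak_dual_solution_on G m T u0 u \<longleftrightarrow>
    solution_class m T u0 u \<and>
    (AE (\<tau>1, \<tau>2) in lborel. 0 < \<tau>1 \<and> \<tau>1 \<le> \<tau>2 \<and> \<tau>2 \<le> T \<longrightarrow>
      (\<forall>\<psi> \<psi>'. test_curve \<tau>1 \<tau>2 \<psi> \<psi>' \<longrightarrow>
        set_integrable lborel ({\<tau>1..\<tau>2} \<times> UNIV)
          (\<lambda>(t, x). green_inv G (u t) x * \<psi>' t x - u t x powr m * \<psi> t x) \<and>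
        integrable lborel (\<lambda>x. green_inv G (u \<tau>2) x * \<psi> \<tau>2 x) \<and>
        integrable lborel (\<lambda>x. green_inv G (u \<tau>1) x * \<psi> \<tau>1 x) \<and>
        (LINT (t, x):{\<tau>1..\<tau>2} \<times> UNIV|lborel.
            green_inv G (u t) x * \<psi>' t x - u t x powr m * \<psi> t x)
          = (\<integral>x. green_inv G (u \<tau>2) x * \<psi> \<tau>2 x \<partial>lborel)
            - (\<integral>x. green_inv G (u \<tau>1) x * \<psi> \<tau>1 x \<partial>lborel)))"

definition weak_dual_solution_resolvent_on ::
  "('a::euclidean_space \<Rightarrow> 'a \<Rightarrow> real) \<Rightarrow> real \<Rightarrow> real \<Rightarrow> ('a \<Rightarrow> real) \<Rightarrow> (real \<Rightarrow> 'a \<Rightarrow> real) \<Rightarrow> bool"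
where
  "weak_dual_solution_resolvent_on G m T u0 u \<longleftrightarrow>
    solution_class m T u0 u \<and>
    (AE (\<tau>1, \<tau>2) in lborel. 0 < \<tau>1 \<and> \<tau>1 \<le> \<tau>2 \<and> \<tau>2 \<le> T \<longrightarrow>
      (\<forall>\<psi> \<psi>'. test_curve \<tau>1 \<tau>2 \<psi> \<psi>' \<longrightarrow>
        set_integrable lborel ({\<tau>1..\<tau>2} \<times> UNIV)
          (\<lambda>(t, x). green_inv G (u t) x * \<psi>' t x - u t x powr m * \<psi> t x
                     + u t x powr m * green_inv G (\<psi> t) x) \<and>
        integrable lborel (\<lambda>x. green_inv G (u \<tau>2) x * \<psi> \<tau>2 x) \<and>
        integrable lborel (\<lambda>x. green_inv G (u \<tau>1) x * \<psi> \<tau>1 x) \<and>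
        (LINT (t, x):{\<tau>1..\<tau>2} \<times> UNIV|lborel.
            green_inv G (u t) x * \<psi>' t x - u t x powr m * \<psi> t x
            + u t x powr m * green_inv G (\<psi> t) x)
          = (\<integral>x. green_inv G (u \<tau>2) x * \<psi> \<tau>2 x \<partial>lborel)
            - (\<integral>x. green_inv G (u \<tau>1) x * \<psi> \<tau>1 x \<partial>lborel)))"

definition weak_dual_solution ::
  "('a::euclidean_space \<Rightarrow> 'a \<Rightarrow> real) \<Rightarrow> real \<Rightarrow> ('a \<Rightarrow> real) \<Rightarrow> (real \<Rightarrow> 'a \<Rightarrow> real) \<Rightarrow> bool" where
  "weak_dual_solution G m u0 u \<longleftrightarrow> (\<forall>T>0. weak_dual_solution_on G m T u0 u)"

definition weak_dual_solution_resolvent ::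
  "('a::euclidean_space \<Rightarrow> 'a \<Rightarrow> real) \<Rightarrow> real \<Rightarrow> ('a \<Rightarrow> real) \<Rightarrow> (real \<Rightarrow> 'a \<Rightarrow> real) \<Rightarrow> bool" where
  "weak_dual_solution_resolvent G m u0 u \<longleftrightarrow>
    (\<forall>T>0. weak_dual_solution_resolvent_on G m T u0 u)"

text \<open>
  In the next two definitions \<open>S u0 u\<close> reads: \<open>u\<close> is a solution with initial datum \<open>u0\<close>. The decay
  is required for almost all pairs of times and, separately, from the initial time, which
  is invisible to almost all pairs.
\<close>

definition comparison_principle ::
  "(('a::euclidean_space \<Rightarrow> real) \<Rightarrow> (real \<Rightarrow> 'a \<Rightarrow> real) \<Rightarrow> bool) \<Rightarrow> bool" where
  "comparison_principle S \<longleftrightarrow>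
    (\<forall>u0 v0 u v. initial_datum u0 \<and> initial_datum v0 \<and> S u0 u \<and> S v0 v \<and>
       (AE x in lborel. u0 x \<le> v0 x) \<longrightarrow>
       (AE (t, x) in lborel. 0 < t \<longrightarrow> u t x \<le> v t x))"

definition Lp_decay ::
  "(('a::euclidean_space \<Rightarrow> real) \<Rightarrow> (real \<Rightarrow> 'a \<Rightarrow> real) \<Rightarrow> bool) \<Rightarrow> bool" where
  "Lp_decay S \<longleftrightarrow>
    (\<forall>u0 u r. initial_datum u0 \<and> S u0 u \<and> 1 \<le> r \<longrightarrow>
       (AE (\<tau>1, \<tau>2) in lborel. 0 \<le> \<tau>1 \<and> \<tau>1 \<le> \<tau>2 \<longrightarrow> lnorm r (u \<tau>2) \<le> lnorm r (u \<tau>1)) \<and>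
       (AE \<tau> in lborel. 0 \<le> \<tau> \<longrightarrow> lnorm r (u \<tau>) \<le> lnorm r (u 0)))"

section \<open>Pointwise values\<close>

text \<open>
  The balls in \<open>real \<times> 'a\<close> are Euclidean; they can be used in place of space-time cylinders.
  \<open>precise_version u\<close> is the limit of the averages wherever it exists.
\<close>

definition ball_average :: "('b::euclidean_space \<Rightarrow> real) \<Rightarrow> 'b \<Rightarrow> real \<Rightarrow> real" where
  "ball_average f z r = (LINT y:ball z r|lborel. f y) / measure lborel (ball z r)"

definition precise_version :: "(real \<Rightarrow> 'a::euclidean_space \<Rightarrow> real) \<Rightarrow> real \<Rightarrow> 'a \<Rightarrow> real" where
  "precise_version u t x =
    (if \<exists>l. ((\<lambda>r. ball_average (\<lambda>(s, y). u s y) (t, x) r) \<longlongrightarrow> l) (at_right 0)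
     then Lim (at_right 0) (\<lambda>r. ball_average (\<lambda>(s, y). u s y) (t, x) r)
     else u t x)"

text \<open>
  Here \<open>x\<close> may be a Lebesgue point at time \<open>t\<close> either of the function of space-time or of its
  section at time \<open>t\<close>. The value tested is the one of the version fixed above; inside the
  integrals any version can be used.
\<close>

definition lebesgue_point :: "(real \<Rightarrow> 'a::euclidean_space \<Rightarrow> real) \<Rightarrow> real \<Rightarrow> 'a \<Rightarrow> bool" where
  "lebesgue_point u t x \<longleftrightarrow>
    ((\<lambda>r. ball_average (\<lambda>(s, y). \<bar>u s y - precise_version u t x\<bar>) (t, x) r) \<longlongrightarrow> 0) (at_right 0) \<or>
    ((\<lambda>r. ball_average (\<lambda>y. \<bar>u t y - precise_version u t x\<bar>) x r) \<longlongrightarrow> 0) (at_right 0)"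

end

theory Submission
  imports Defs
begin

text \<open>
  Write \<open>v(t) = G * u(t)\<close> for the potential of the solution and \<open>q = m / (m - 1)\<close>. The result is a
  pointwise bound of \<open>u(\<tau>)\<^sup>m\<close> by \<open>v(\<tau>)\<close>, and three ingredients yield it.

  First, \<open>u\<close> cannot decrease too fast in time: \<open>u(\<tau>)\<^sup>m \<le> (t / \<tau>)\<^sup>q u(t)\<^sup>m\<close> for \<open>\<tau> \<le> t\<close>, the estimate
  of Benilan and Crandall. The equation is invariant under \<open>u(t) \<mapsto> k u(k\<^sup>m\<^sup>-\<^sup>1 t)\<close>, so for \<open>k \<ge> 1\<close>
  the rescaled solution has a larger datum and the comparison principle applies
  (\<open>dual_solution_scaling\<close>, \<open>solution_time_monotone\<close>).

  Second, the dual formulation says that \<open>\<partial>\<^sub>t v = - u\<^sup>m\<close> for the operator \<open>-\<LL>\<close>, and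
  \<open>\<partial>\<^sub>t v = - u\<^sup>m + G * u\<^sup>m\<close> for \<open>I - \<LL>\<close>. In the second case \<open>u\<^sup>m \<le> L u\<close> after time \<open>\<tau>\<close>, with
  \<open>L\<close> the power \<open>m - 1\<close> of the supremum of \<open>u(\<tau>)\<close>, by decay of the supremum; hence
  \<open>\<partial>\<^sub>t v \<le> L v - u\<^sup>m\<close>. Testing with \<open>exp(-L (t - \<tau>))\<close> times the indicator of a bounded set, dropping
  \<open>v \<ge> 0\<close> at the final time and using the time monotonicity,
  \<open>v(\<tau>) \<ge> (\<integral> exp(-L (t - \<tau>)) dt) (1 + h / \<tau>)\<^sup>-\<^sup>q u(\<tau>)\<^sup>m\<close> almost everywhere, the integral being over
  \<open>[\<tau>, \<tau> + h]\<close> (\<open>fundamental_pointwise_bound\<close>). For the operator \<open>-\<LL>\<close> one takes \<open>L = 0\<close> and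
  \<open>h = \<tau>\<close>; for \<open>I - \<LL>\<close> one takes \<open>h = 1 / L\<close>, where \<open>1 - 1/e \<ge> 1/2\<close>.

  Third, the bound has to be carried from almost every point to every Lebesgue point, which needs
  continuity of \<open>v\<close>. Each of the conditions on the Green function makes it a sum of a bounded
  function and of a function of arbitrarily small \<open>L\<^sup>1\<close> norm (\<open>green_function_tame\<close>,
  \<open>tame_kernel_decomposition\<close>); as \<open>u\<close> is bounded, integrable and continuous in time with values in
  \<open>L\<^sup>1\<close>, continuity of translations in \<open>L\<^sup>1\<close> makes \<open>v\<close> continuous in space and time
  (\<open>green_inv_tendsto\<close>). Since the admissible constants only improve after time \<open>\<tau>\<close>, the points at
  which the bound is used are selected in the half-space of later times (\<open>lebesgue_point_sequence\<close>).
\<close>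

section \<open>Translations\<close>

lemma
  fixes t :: "'a::euclidean_space" and f :: "'a \<Rightarrow> real"
  shows integrable_translation: "integrable lborel (\<lambda>x. f (t + x)) \<longleftrightarrow> integrable lborel f"
    and integral_translation: "(\<integral>x. f (t + x) \<partial>lborel) = (\<integral>x. f x \<partial>lborel)"
proof -
  have imp: "integrable lborel (\<lambda>x. g (s + x))" if "integrable lborel g" for g :: "'a \<Rightarrow> real" and s
  proof -
    have "integrable (distr lborel borel ((+) s)) g"
      by (subst lborel_distr_plus) (rule that)
    then show ?thesis by (rule integrable_distr[rotated]) measurable
  qed
  show int: "integrable lborel (\<lambda>x. f (t + x)) \<longleftrightarrow> integrable lborel f"
  proof
    assume "integrable lborel (\<lambda>x. f (t + x))"
    from imp[OF this, of "- t"] show "integrable lborel f" by simp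
  qed (rule imp)
  show "(\<integral>x. f (t + x) \<partial>lborel) = (\<integral>x. f x \<partial>lborel)"
  proof (cases "integrable lborel f")
    case True
    then have [measurable]: "f \<in> borel_measurable borel" by auto
    have "(\<integral>x. f x \<partial>distr lborel borel ((+) t)) = (\<integral>x. f (t + x) \<partial>lborel)"
      by (rule integral_distr) auto
    then show ?thesis by (simp add: lborel_distr_plus)
  next
    case False
    then show ?thesis using int by (simp add: not_integrable_integral_eq)
  qed
qed

lemma AE_translation:
  fixes t :: "'a::euclidean_space"
  assumes P: "AE x in lborel. P x"
  shows "AE x in lborel. P (t + x)"
proof -
  have "AE x in distr lborel borel ((+) t). P x"
    by (subst lborel_distr_plus) (rule P)
  then show ?thesis by (rule AE_distrD[rotated]) auto
qed

section \<open>Continuity of translations in the mean\<close>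

text \<open>
  For an open set \<open>U\<close> the part of \<open>U\<close> that a small translation moves out of \<open>U\<close> tends to the empty
  set; what is moved in has the same measure.
\<close>

lemma L1_translation_indicator_open:
  fixes U :: "'a::euclidean_space set"
  assumes U: "open U" "emeasure lborel U < \<infinity>" and X: "X \<longlonglongrightarrow> 0"
  shows "(\<lambda>n. \<integral>x. \<bar>indicator U (x + X n) - indicator U x\<bar> \<partial>lborel) \<longlonglongrightarrow> (0::real)"
proof -
  let ?I = "indicator U :: 'a \<Rightarrow> real"
  have iU: "integrable lborel ?I" using U by auto
  have sh: "integrable lborel (\<lambda>x. ?I (x + X n))" for n
    using integrable_translation[of ?I "X n"] iU by (simp add: add.commute)
  have meas[measurable]: "?I \<in> borel_measurable borel" using iU by auto
  have lim: "(\<lambda>n. \<integral>x. max 0 (?I x - ?I (x + X n)) \<partial>lborel) \<longlonglongrightarrow> (\<integral>x. (0::real) \<partial>(lborel :: 'a measure))"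
  proof (rule integral_dominated_convergence[where w="?I"])
    show "AE x in lborel. (\<lambda>n. max 0 (?I x - ?I (x + X n))) \<longlonglongrightarrow> 0"
    proof (rule AE_I2)
      fix x :: 'a
      show "(\<lambda>n. max 0 (?I x - ?I (x + X n))) \<longlonglongrightarrow> 0"
      proof (cases "x \<in> U")
        case True
        have "(\<lambda>n. x + X n) \<longlonglongrightarrow> x + 0" using X by (intro tendsto_intros)
        then have "eventually (\<lambda>n. x + X n \<in> U) sequentially"
          using U(1) True by (simp add: topological_tendstoD)
        then have "eventually (\<lambda>n. max 0 (?I x - ?I (x + X n)) = 0) sequentially"
          by eventually_elim (use True in auto)
        then show ?thesis by (rule tendsto_eventually)
      next
        case False
        then have "max 0 (?I x - ?I (x + X n)) = 0" for n by (auto simp: indicator_def)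
        then show ?thesis by simp
      qed
    qed
    show "AE x in lborel. norm (max 0 (?I x - ?I (x + X n))) \<le> ?I x" for n
      by (auto simp: indicator_def)
  qed (use iU in auto)
  have eq: "(\<integral>x. \<bar>?I (x + X n) - ?I x\<bar> \<partial>lborel) = 2 * (\<integral>x. max 0 (?I x - ?I (x + X n)) \<partial>lborel)" for n
  proof -
    have i1: "integrable lborel (\<lambda>x. max 0 (?I x - ?I (x + X n)))"
      using iU sh by (intro integrable_max Bochner_Integration.integrable_diff) auto
    have "(\<lambda>x. \<bar>?I (x + X n) - ?I x\<bar>) =
        (\<lambda>x. 2 * max 0 (?I x - ?I (x + X n)) + (?I (x + X n) - ?I x))"
      by (auto simp: fun_eq_iff max_def abs_if)
    then have "(\<integral>x. \<bar>?I (x + X n) - ?I x\<bar> \<partial>lborel) =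
        2 * (\<integral>x. max 0 (?I x - ?I (x + X n)) \<partial>lborel) +
        ((\<integral>x. ?I (x + X n) \<partial>lborel) - (\<integral>x. ?I x \<partial>lborel))"
      using i1 iU sh[of n] by (simp)
    moreover have "(\<integral>x. ?I (x + X n) \<partial>lborel) = (\<integral>x. ?I x \<partial>lborel)"
      using integral_translation[of ?I "X n"] by (simp add: add.commute)
    ultimately show ?thesis by simp
  qed
  show ?thesis unfolding eq using tendsto_mult_right_zero[of _ _ 2] lim by simp
qed

lemma L1_dist_triangle:
  fixes f g h :: "'b \<Rightarrow> real"
  assumes "integrable M f" "integrable M g" "integrable M h"
  shows "(\<integral>x. \<bar>f x - h x\<bar> \<partial>M) \<le> (\<integral>x. \<bar>f x - g x\<bar> \<partial>M) + (\<integral>x. \<bar>g x - h x\<bar> \<partial>M)"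
proof -
  have "(\<integral>x. \<bar>f x - h x\<bar> \<partial>M) \<le> (\<integral>x. \<bar>f x - g x\<bar> + \<bar>g x - h x\<bar> \<partial>M)"
    using assms by (intro integral_mono) auto
  also have "\<dots> = (\<integral>x. \<bar>f x - g x\<bar> \<partial>M) + (\<integral>x. \<bar>g x - h x\<bar> \<partial>M)"
    using assms by simp
  finally show ?thesis .
qed

text \<open>The functions whose translations are continuous in the mean form a closed subset of \<open>L\<^sup>1\<close>.\<close>

lemma L1_translation_approx:
  fixes f :: "'a::euclidean_space \<Rightarrow> real"
  assumes f: "integrable lborel f"
    and g: "\<And>e. e > 0 \<Longrightarrow> \<exists>g. integrable lborel g \<and> (\<integral>x. \<bar>f x - g x\<bar> \<partial>lborel) < e \<and>
       (\<lambda>n. \<integral>x. \<bar>g (x + X n) - g x\<bar> \<partial>lborel) \<longlonglongrightarrow> 0"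
  shows "(\<lambda>n. \<integral>x. \<bar>f (x + X n) - f x\<bar> \<partial>lborel) \<longlonglongrightarrow> 0"
proof (rule LIMSEQ_I)
  fix r :: real assume r: "0 < r"
  obtain g where gi: "integrable lborel g" and fg: "(\<integral>x. \<bar>f x - g x\<bar> \<partial>lborel) < r / 3"
    and lim: "(\<lambda>n. \<integral>x. \<bar>g (x + X n) - g x\<bar> \<partial>lborel) \<longlonglongrightarrow> 0"
    using g[of "r/3"] r by auto
  obtain N where N: "\<And>n. n \<ge> N \<Longrightarrow> norm ((\<integral>x. \<bar>g (x + X n) - g x\<bar> \<partial>lborel) - 0) < r/3"
    using LIMSEQ_D[OF lim, of "r/3"] r by auto
  have "norm ((\<integral>x. \<bar>f (x + X n) - f x\<bar> \<partial>lborel) - 0) < r" if n: "n \<ge> N" for n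
  proof -
    have sh: "integrable lborel (\<lambda>x. k (x + X n))" if "integrable lborel k" for k :: "'a \<Rightarrow> real"
      using integrable_translation[of k "X n"] that by (simp add: add.commute)
    have "(\<integral>x. \<bar>f (x + X n) - f x\<bar> \<partial>lborel) \<le>
        (\<integral>x. \<bar>f (x + X n) - g (x + X n)\<bar> \<partial>lborel) + (\<integral>x. \<bar>g (x + X n) - f x\<bar> \<partial>lborel)"
      by (intro L1_dist_triangle sh f gi)
    also have "(\<integral>x. \<bar>g (x + X n) - f x\<bar> \<partial>lborel) \<le>
        (\<integral>x. \<bar>g (x + X n) - g x\<bar> \<partial>lborel) + (\<integral>x. \<bar>g x - f x\<bar> \<partial>lborel)"
      by (intro L1_dist_triangle sh f gi)
    also have "(\<integral>x. \<bar>f (x + X n) - g (x + X n)\<bar> \<partial>lborel) = (\<integral>x. \<bar>f x - g x\<bar> \<partial>lborel)"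
      using integral_translation[of "\<lambda>x. \<bar>f x - g x\<bar>" "X n"] by (simp add: add.commute)
    also have "(\<integral>x. \<bar>g x - f x\<bar> \<partial>lborel) = (\<integral>x. \<bar>f x - g x\<bar> \<partial>lborel)"
      by (simp add: abs_minus_commute)
    finally show ?thesis using fg N[OF n] by simp
  qed
  then show "\<exists>no. \<forall>n\<ge>no. norm ((\<integral>x. \<bar>f (x + X n) - f x\<bar> \<partial>lborel) - 0) < r" by blast
qed

proposition L1_translation_tendsto:
  fixes f :: "'a::euclidean_space \<Rightarrow> real"
  assumes f: "integrable lborel f" and X: "X \<longlonglongrightarrow> 0"
  shows "(\<lambda>n. \<integral>x. \<bar>f (x + X n) - f x\<bar> \<partial>lborel) \<longlonglongrightarrow> 0"
  using f
proof (induction rule: integrable_induct)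
  case (base A c)
  have Ab: "A \<in> sets borel" using base by simp
  have iA: "integrable lborel (indicator A :: 'a \<Rightarrow> real)" using base by auto
  have "(\<lambda>n. \<integral>x. \<bar>indicator A (x + X n) - indicator A x\<bar> \<partial>lborel) \<longlonglongrightarrow> (0::real)"
  proof (rule L1_translation_approx[OF iA])
    fix e :: real assume "e > 0"
    then obtain U where U: "open U" "A \<subseteq> U" "emeasure lborel (U - A) < e"
      using outer_regular_lborel[OF Ab] by blast
    have "emeasure lborel U \<le> emeasure lborel A + emeasure lborel (U - A)"
      using U(2) emeasure_subadditive[of A lborel "U - A"] Ab U(1)
      by (simp add: Un_absorb1)
    also have "\<dots> < \<infinity>" using base U(3) by (auto simp: ennreal_add_less_top intro: less_trans)
    finally have fU: "emeasure lborel U < \<infinity>" .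
    have "(\<integral>x. \<bar>indicator A x - indicator U x\<bar> \<partial>lborel) = (\<integral>x. indicator (U - A) x \<partial>lborel :: real)"
      using U(2) by (intro Bochner_Integration.integral_cong) (auto simp: indicator_def)
    also have "\<dots> = measure lborel (U - A)" by simp
    also have "\<dots> < e" using U(3) \<open>e > 0\<close>
      by (metis emeasure_eq_ennreal_measure ennreal_less_iff less_top measure_nonneg top.not_eq_extremum order_less_trans ennreal_less_top)
    finally show "\<exists>g. integrable lborel g \<and> (\<integral>x. \<bar>indicator A x - g x\<bar> \<partial>lborel) < e \<and>
       (\<lambda>n. \<integral>x. \<bar>g (x + X n) - g x\<bar> \<partial>lborel) \<longlonglongrightarrow> 0"
      using L1_translation_indicator_open[OF U(1) fU X] U(1) fU
      by (intro exI[of _ "indicator U"]) auto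
  qed
  then have "(\<lambda>n. \<bar>c\<bar> * (\<integral>x. \<bar>indicator A (x + X n) - indicator A x\<bar> \<partial>lborel)) \<longlonglongrightarrow> (0::real)"
    by (rule tendsto_mult_right_zero)
  then show ?case
    by (simp flip: left_diff_distrib right_diff_distrib Bochner_Integration.integral_mult_right_zero
      add: abs_mult mult.commute)
next
  case (add f g)
  have sh: "integrable lborel (\<lambda>x. k (x + X n))" if "integrable lborel k" for n and k :: "'a \<Rightarrow> real"
    using integrable_translation[of k "X n"] that by (simp add: add.commute)
  have "(\<lambda>n. (\<integral>x. \<bar>f (x + X n) - f x\<bar> \<partial>lborel) + (\<integral>x. \<bar>g (x + X n) - g x\<bar> \<partial>lborel)) \<longlonglongrightarrow> 0"
    using tendsto_add[OF add.IH] by simp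
  then show ?case
  proof (rule tendsto_sandwich[OF _ _ tendsto_const, rotated 2])
    show "\<forall>\<^sub>F n in sequentially. 0 \<le> (\<integral>x. \<bar>f (x + X n) + g (x + X n) - (f x + g x)\<bar> \<partial>lborel)"
      by simp
    have "(\<integral>x. \<bar>f (x + X n) + g (x + X n) - (f x + g x)\<bar> \<partial>lborel) \<le>
       (\<integral>x. \<bar>f (x + X n) - f x\<bar> + \<bar>g (x + X n) - g x\<bar> \<partial>lborel)" for n
      using add.hyps sh by (intro integral_mono) auto
    also have "\<dots> n = (\<integral>x. \<bar>f (x + X n) - f x\<bar> \<partial>lborel) + (\<integral>x. \<bar>g (x + X n) - g x\<bar> \<partial>lborel)" for n
      using add.hyps sh by simp
    finally show "\<forall>\<^sub>F n in sequentially. (\<integral>x. \<bar>f (x + X n) + g (x + X n) - (f x + g x)\<bar> \<partial>lborel) \<le>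
        (\<integral>x. \<bar>f (x + X n) - f x\<bar> \<partial>lborel) + (\<integral>x. \<bar>g (x + X n) - g x\<bar> \<partial>lborel)"
      by simp
  qed
next
  case (lim f s)
  show ?case
  proof (rule L1_translation_approx[OF lim.hyps(4)])
    fix e :: real assume e: "e > 0"
    have [measurable]: "f \<in> borel_measurable borel" "s i \<in> borel_measurable borel" for i
      using lim.hyps by auto
    have "(\<lambda>i. \<integral>x. \<bar>f x - s i x\<bar> \<partial>lborel) \<longlonglongrightarrow> (\<integral>x. (0::real) \<partial>(lborel :: 'a measure))"
    proof (rule integral_dominated_convergence[where w="\<lambda>x. 3 * \<bar>f x\<bar>"])
      show "AE x in lborel. (\<lambda>i. \<bar>f x - s i x\<bar>) \<longlonglongrightarrow> 0"
      proof (rule AE_I2)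
        fix x :: 'a
        have "(\<lambda>i. \<bar>f x - s i x\<bar>) \<longlonglongrightarrow> \<bar>f x - f x\<bar>"
          using lim.hyps(2)[of x] by (intro tendsto_intros) auto
        then show "(\<lambda>i. \<bar>f x - s i x\<bar>) \<longlonglongrightarrow> 0" by simp
      qed
      show "AE x in lborel. norm \<bar>f x - s i x\<bar> \<le> 3 * \<bar>f x\<bar>" for i
      proof (rule AE_I2)
        fix x :: 'a
        show "norm \<bar>f x - s i x\<bar> \<le> 3 * \<bar>f x\<bar>" using lim.hyps(3)[of x i] by auto
      qed
      show "integrable lborel (\<lambda>x. 3 * \<bar>f x\<bar>)" using lim.hyps(4) by auto
    qed measurable
    then have "\<forall>\<^sub>F i in sequentially. (\<integral>x. \<bar>f x - s i x\<bar> \<partial>lborel) < e"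
      using e by (simp add: order_tendsto_iff)
    then obtain i where "(\<integral>x. \<bar>f x - s i x\<bar> \<partial>lborel) < e"
      by (metis (mono_tags) eventually_sequentially order_refl)
    then show "\<exists>g. integrable lborel g \<and> (\<integral>x. \<bar>f x - g x\<bar> \<partial>lborel) < e \<and>
       (\<lambda>n. \<integral>x. \<bar>g (x + X n) - g x\<bar> \<partial>lborel) \<longlonglongrightarrow> 0"
      using lim.hyps(1) lim.IH by blast
  qed
qed

section \<open>Essential bounds\<close>

lemma lnorm_infinity_AE:
  assumes "lnorm \<infinity> f < \<infinity>"
  shows "AE x in lborel. \<bar>f x\<bar> \<le> enn2real (lnorm \<infinity> f)"
proof -
  have "AE x in lborel. ennreal \<bar>f x\<bar> \<le> lnorm \<infinity> f"
    using esssup_AE[of "\<lambda>x. ennreal \<bar>f x\<bar>" lborel] by (simp add: lnorm_def)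
  then show ?thesis
  proof eventually_elim
    case (elim x)
    then have "enn2real (ennreal \<bar>f x\<bar>) \<le> enn2real (lnorm \<infinity> f)"
      using assms by (intro enn2real_mono) auto
    then show ?case by simp
  qed
qed

lemma lnorm_infinity_le:
  assumes [measurable]: "f \<in> borel_measurable borel" and "AE x in lborel. \<bar>f x\<bar> \<le> M"
  shows "lnorm \<infinity> f \<le> ennreal M"
  unfolding lnorm_def using assms(2)
  by (auto intro!: esssup_I ennreal_leI elim!: eventually_mono)

lemma integrable_mult_bounded:
  fixes f B :: "'b \<Rightarrow> real"
  assumes f: "integrable M f" and [measurable]: "B \<in> borel_measurable M" and B: "\<And>x. \<bar>B x\<bar> \<le> C"
  shows "integrable M (\<lambda>x. f x * B x)"
proof (rule Bochner_Integration.integrable_bound)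
  have [measurable]: "f \<in> borel_measurable M" using f by auto
  show "integrable M (\<lambda>x. C * f x)" using f by auto
  show "(\<lambda>x. f x * B x) \<in> borel_measurable M" by measurable
  have "0 \<le> C" using B[of undefined] by simp
  then show "AE x in M. norm (f x * B x) \<le> norm (C * f x)"
    using B by (intro AE_I2) (auto simp: abs_mult mult.commute intro!: mult_right_mono)
qed

section \<open>Convolution with a locally integrable kernel that is bounded off an integrable part\<close>

text \<open>
  The only information on the Green function that enters the estimates: \<open>g\<close> is nonnegative, even,
  and its part above some level is integrable.
\<close>

definition tame_kernel :: "('a::euclidean_space \<Rightarrow> real) \<Rightarrow> bool" where
  "tame_kernel g \<longleftrightarrow>
    g \<in> borel_measurable borel \<and> (AE x in lborel. 0 \<le> g x \<and> g x = g (- x)) \<and>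
    (\<exists>k\<ge>0. integrable lborel (\<lambda>x. indicator {x. k < g x} x * g x))"

lemma tame_kernel_measurable: "tame_kernel g \<Longrightarrow> g \<in> borel_measurable borel"
  by (simp add: tame_kernel_def)

lemma tame_kernelI:
  fixes g :: "'a::euclidean_space \<Rightarrow> real"
  assumes [measurable]: "g \<in> borel_measurable borel"
    and "AE x in lborel. 0 \<le> g x \<and> g x = g (- x)"
    and k: "0 \<le> k" and h: "integrable lborel h" and le: "AE x in lborel. k < g x \<longrightarrow> g x \<le> h x"
  shows "tame_kernel g"
proof -
  have "integrable lborel (\<lambda>x. indicator {x. k < g x} x * g x)"
  proof (rule Bochner_Integration.integrable_bound)
    show "integrable lborel (\<lambda>x. \<bar>h x\<bar>)" using h by simp
    show "AE x in lborel. norm (indicator {x. k < g x} x * g x) \<le> norm \<bar>h x\<bar>"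
      using le by eventually_elim (use k in \<open>auto simp: indicator_def\<close>)
  qed measurable
  then show ?thesis using assms by (auto simp: tame_kernel_def)
qed

lemma tame_kernel_decomposition:
  fixes g :: "'a::euclidean_space \<Rightarrow> real"
  assumes g: "tame_kernel g" and e: "e > 0"
  obtains k h where "0 \<le> k" "integrable lborel h" "\<And>x. 0 \<le> h x" "(\<integral>x. h x \<partial>lborel) < e"
    "AE x in lborel. \<bar>g x - h x\<bar> \<le> k"
proof -
  note [measurable] = tame_kernel_measurable[OF g]
  obtain k0 where k0: "0 \<le> k0" and int: "integrable lborel (\<lambda>x. indicator {x. k0 < g x} x * g x)"
    using g by (auto simp: tame_kernel_def)
  define h where "h n x = indicator {x. k0 + real n < g x} x * g x" for n x
  have [measurable]: "h n \<in> borel_measurable borel" for n unfolding h_def by measurable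
  have h0: "0 \<le> h n x" for n x using k0 by (auto simp: h_def indicator_def)
  have hle: "h n x \<le> indicator {x. k0 < g x} x * g x" for n x
    using k0 by (auto simp: h_def indicator_def)
  have hi: "integrable lborel (h n)" for n
    by (rule Bochner_Integration.integrable_bound[OF int])
       (auto intro!: AE_I2 simp: h0 abs_of_nonneg intro: order_trans[OF hle])
  have "(\<lambda>n. \<integral>x. h n x \<partial>lborel) \<longlonglongrightarrow> (\<integral>x. (0::real) \<partial>(lborel :: 'a measure))"
  proof (rule integral_dominated_convergence[OF _ _ int])
    show "AE x in lborel. (\<lambda>n. h n x) \<longlonglongrightarrow> 0"
    proof (rule AE_I2)
      fix x
      obtain N :: nat where "g x \<le> real N" using real_arch_simple by blast
      then have "h n x = 0" if "n \<ge> N" for n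
        using that k0 by (auto simp: h_def indicator_def)
      then show "(\<lambda>n. h n x) \<longlonglongrightarrow> 0"
        by (intro tendsto_eventually) (auto simp: eventually_sequentially)
    qed
  qed (use hle h0 in \<open>auto simp: abs_of_nonneg\<close>)
  then have "\<forall>\<^sub>F n in sequentially. (\<integral>x. h n x \<partial>lborel) < e"
    using e by (simp add: order_tendsto_iff)
  then obtain n where n: "(\<integral>x. h n x \<partial>lborel) < e"
    by (metis (mono_tags) eventually_sequentially order_refl)
  have "AE x in lborel. 0 \<le> g x" using g by (auto simp: tame_kernel_def)
  then have "AE x in lborel. \<bar>g x - h n x\<bar> \<le> k0 + real n"
    by eventually_elim (use k0 in \<open>auto simp: h_def indicator_def\<close>)
  then show thesis using that[of "k0 + real n" "h n"] k0 hi h0 n by auto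
qed

lemma integrable_translated_kernel:
  fixes h :: "'a::euclidean_space \<Rightarrow> real"
  shows "integrable lborel h \<Longrightarrow> integrable lborel (\<lambda>x. h (x - y))"
  using integrable_translation[of h "- y"] by simp

text \<open>Here \<open>h\<close> is the integrable part of \<open>g\<close>, and \<open>k\<close> bounds the rest.\<close>

lemma
  fixes g :: "'a::euclidean_space \<Rightarrow> real"
  assumes gm[measurable]: "g \<in> borel_measurable borel"
    and k: "0 \<le> k" and h: "integrable lborel h" "\<And>x. 0 \<le> h x" "AE x in lborel. \<bar>g x - h x\<bar> \<le> k"
    and f: "integrable lborel f" "AE x in lborel. \<bar>f x\<bar> \<le> M"
  shows integrable_convolution: "integrable lborel (\<lambda>x. g (x - y) * f x)"
    and convolution_bound:
      "\<bar>\<integral>x. g (x - y) * f x \<partial>lborel\<bar> \<le> k * (\<integral>x. \<bar>f x\<bar> \<partial>lborel) + M * (\<integral>x. h x \<partial>lborel)"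
proof -
  have [measurable]: "f \<in> borel_measurable borel" "h \<in> borel_measurable borel" using f h by auto
  have hy: "integrable lborel (\<lambda>x. h (x - y))" using h(1) by (rule integrable_translated_kernel)
  have "AE x in lborel. \<bar>g (x - y) - h (x - y)\<bar> \<le> k"
    using AE_translation[OF h(3), of "- y"] by simp
  with f(2) have le: "AE x in lborel. \<bar>g (x - y) * f x\<bar> \<le> k * \<bar>f x\<bar> + M * h (x - y)"
  proof eventually_elim
    case (elim x)
    have "\<bar>g (x - y) * f x\<bar> = \<bar>(g (x - y) - h (x - y)) * f x + h (x - y) * f x\<bar>"
      by (simp add: algebra_simps)
    also have "\<dots> \<le> \<bar>g (x - y) - h (x - y)\<bar> * \<bar>f x\<bar> + h (x - y) * \<bar>f x\<bar>"
      using h(2) by (intro order_trans[OF abs_triangle_ineq]) (simp add: abs_mult)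
    also have "\<dots> \<le> k * \<bar>f x\<bar> + M * h (x - y)"
      using elim h(2)[of "x - y"]
      by (intro add_mono) (auto intro!: mult_mono simp: mult.commute[of M])
    finally show ?case .
  qed
  have dom: "integrable lborel (\<lambda>x. k * \<bar>f x\<bar> + M * h (x - y))" using f(1) hy by auto
  show int: "integrable lborel (\<lambda>x. g (x - y) * f x)"
    by (rule Bochner_Integration.integrable_bound[OF dom]) (use le in \<open>auto elim!: eventually_mono\<close>)
  have "\<bar>\<integral>x. g (x - y) * f x \<partial>lborel\<bar> \<le> (\<integral>x. \<bar>g (x - y) * f x\<bar> \<partial>lborel)"
    by (rule integral_abs_bound)
  also have "\<dots> \<le> (\<integral>x. k * \<bar>f x\<bar> + M * h (x - y) \<partial>lborel)"
    using int dom le by (intro integral_mono_AE) auto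
  also have "\<dots> = k * (\<integral>x. \<bar>f x\<bar> \<partial>lborel) + M * (\<integral>x. h (x - y) \<partial>lborel)"
    using f(1) hy by simp
  also have "(\<integral>x. h (x - y) \<partial>lborel) = (\<integral>x. h x \<partial>lborel)"
    using integral_translation[of h "- y"] by simp
  finally show "\<bar>\<integral>x. g (x - y) * f x \<partial>lborel\<bar>
    \<le> k * (\<integral>x. \<bar>f x\<bar> \<partial>lborel) + M * (\<integral>x. h x \<partial>lborel)" .
qed

lemma kernel_mult_integrable:
  fixes G :: "'a::euclidean_space \<Rightarrow> 'a \<Rightarrow> real"
  assumes G: "tame_kernel (G 0)" and "integrable lborel f" "AE x in lborel. \<bar>f x\<bar> \<le> M"
  shows "integrable lborel (\<lambda>x. G 0 (x - y) * f x)"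
proof -
  obtain h k where "0 \<le> k" "integrable lborel h" "\<And>x. 0 \<le> h x" "AE x in lborel. \<bar>G 0 x - h x\<bar> \<le> k"
    by (rule tame_kernel_decomposition[OF G zero_less_one]) (rule that; simp)
  from integrable_convolution[OF tame_kernel_measurable[OF G] this assms(2,3)] show ?thesis .
qed

lemma green_inv_measurable:
  fixes G :: "'a::euclidean_space \<Rightarrow> 'a \<Rightarrow> real"
  assumes G: "tame_kernel (G 0)" and [measurable]: "f \<in> borel_measurable borel"
  shows "green_inv G f \<in> borel_measurable borel"
proof -
  note [measurable] = tame_kernel_measurable[OF G]
  show ?thesis unfolding green_inv_def by measurable
qed

lemma green_inv_bounded:
  fixes G :: "'a::euclidean_space \<Rightarrow> 'a \<Rightarrow> real"
  assumes G: "tame_kernel (G 0)" and "integrable lborel f" "AE x in lborel. \<bar>f x\<bar> \<le> M"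
  obtains C where "\<And>y. \<bar>green_inv G f y\<bar> \<le> C"
proof -
  obtain h k where "0 \<le> k" "integrable lborel h" "\<And>x. 0 \<le> h x" "AE x in lborel. \<bar>G 0 x - h x\<bar> \<le> k"
    by (rule tame_kernel_decomposition[OF G zero_less_one]) (rule that; simp)
  from convolution_bound[OF tame_kernel_measurable[OF G] this assms(2,3)] that
  show thesis unfolding green_inv_def by blast
qed

lemma green_inv_nonneg:
  fixes G :: "'a::euclidean_space \<Rightarrow> 'a \<Rightarrow> real"
  assumes G: "tame_kernel (G 0)" and "AE x in lborel. 0 \<le> f x"
  shows "0 \<le> green_inv G f y"
proof -
  have "AE x in lborel. 0 \<le> G 0 x" using G by (auto simp: tame_kernel_def)
  from AE_translation[OF this, of "- y"] have "AE x in lborel. 0 \<le> G 0 (x - y)" by simp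
  then have "AE x in lborel. 0 \<le> G 0 (x - y) * f x" using assms(2) by eventually_elim auto
  then show ?thesis unfolding green_inv_def by (rule integral_nonneg_AE)
qed

lemma green_inv_even:
  fixes G :: "'a::euclidean_space \<Rightarrow> 'a \<Rightarrow> real"
  assumes G: "tame_kernel (G 0)" and [measurable]: "f \<in> borel_measurable borel"
  shows "green_inv G f x = (\<integral>y. G 0 (x - y) * f y \<partial>lborel)"
proof -
  note [measurable] = tame_kernel_measurable[OF G]
  have "AE z in lborel. G 0 z = G 0 (- z)" using G by (auto simp: tame_kernel_def)
  from AE_translation[OF this, of "- x"] have "AE y in lborel. G 0 (y - x) * f y = G 0 (x - y) * f y"
    by (auto elim: eventually_mono)
  then show ?thesis unfolding green_inv_def by (intro integral_cong_AE) auto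
qed

lemma green_inv_integral_symmetric:
  fixes G :: "'a::euclidean_space \<Rightarrow> 'a \<Rightarrow> real"
  assumes G: "tame_kernel (G 0)"
    and f: "integrable lborel f" "AE x in lborel. \<bar>f x\<bar> \<le> M"
    and p: "integrable lborel p" "AE x in lborel. \<bar>p x\<bar> \<le> N"
  shows "integrable lborel (\<lambda>x. f x * green_inv G p x)"
    and "integrable lborel (\<lambda>y. green_inv G f y * p y)"
    and "(\<integral>x. f x * green_inv G p x \<partial>lborel) = (\<integral>y. green_inv G f y * p y \<partial>lborel)"
proof -
  note [measurable] = tame_kernel_measurable[OF G]
  have [measurable]: "f \<in> borel_measurable borel" "p \<in> borel_measurable borel" using f p by auto
  obtain C where C: "\<And>y. \<bar>green_inv G f y\<bar> \<le> C" using green_inv_bounded[where G=G, OF G f] by blast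
  obtain C' where C': "\<And>y. \<bar>green_inv G p y\<bar> \<le> C'" using green_inv_bounded[where G=G, OF G p] by blast
  have [measurable]: "green_inv G f \<in> borel_measurable borel" "green_inv G p \<in> borel_measurable borel"
    by (auto intro: green_inv_measurable[where G=G, OF G])
  show "integrable lborel (\<lambda>x. f x * green_inv G p x)"
    by (rule integrable_mult_bounded[OF f(1) _ C']) measurable
  show "integrable lborel (\<lambda>y. green_inv G f y * p y)"
    by (subst mult.commute, rule integrable_mult_bounded[OF p(1) _ C]) measurable
  let ?F = "\<lambda>(x, y). G 0 (x - y) * f x * p y"
  have abs_p: "integrable lborel (\<lambda>x. \<bar>p x\<bar>)" "AE x in lborel. \<bar>\<bar>p x\<bar>\<bar> \<le> N"
    using p by auto
  obtain C2 where C2: "\<And>y. \<bar>green_inv G (\<lambda>x. \<bar>p x\<bar>) y\<bar> \<le> C2" using green_inv_bounded[where G=G, OF G abs_p] by blast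
  have AE0: "AE x in lborel. 0 \<le> G 0 x \<and> G 0 x = G 0 (- x)" using G by (auto simp: tame_kernel_def)
  have even: "AE y in lborel. 0 \<le> G 0 (y - x) \<and> G 0 (x - y) = G 0 (y - x)" for x
    using AE_translation[OF AE0, of "- x"] by (rule eventually_mono) auto
  have int2: "integrable lborel (\<lambda>y. G 0 (x - y) * p y)" for x
  proof -
    have "integrable lborel (\<lambda>y. G 0 (y - x) * p y)" by (rule kernel_mult_integrable[where G=G, OF G p])
    then show ?thesis by (rule integrable_cong_AE_imp) (measurable, rule eventually_mono[OF even[of x]], simp)
  qed
  have "integrable (lborel \<Otimes>\<^sub>M lborel) ?F"
  proof (rule lborel_pair.Fubini_integrable)
    have norm_eq: "(\<integral>y. norm (?F (x, y)) \<partial>lborel) = \<bar>f x\<bar> * green_inv G (\<lambda>x. \<bar>p x\<bar>) x" for x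
    proof -
      have "(\<integral>y. norm (?F (x, y)) \<partial>lborel) = (\<integral>y. \<bar>f x\<bar> * (G 0 (y - x) * \<bar>p y\<bar>) \<partial>lborel)"
        unfolding prod.case
        by (intro integral_cong_AE; (measurable; fail | rule eventually_mono[OF even[of x]], simp add: abs_mult))
      then show ?thesis by (simp add: green_inv_def)
    qed
    have [measurable]: "green_inv G (\<lambda>x. \<bar>p x\<bar>) \<in> borel_measurable borel"
      by (auto intro: green_inv_measurable[where G=G, OF G])
    show "integrable lborel (\<lambda>x. \<integral>y. norm (?F (x, y)) \<partial>lborel)"
      unfolding norm_eq
      by (rule integrable_mult_bounded[OF _ _ C2]) (use f(1) in simp, measurable)
    show "AE x in lborel. integrable lborel (\<lambda>y. ?F (x, y))"
    proof (rule AE_I2)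
      fix x :: 'a
      have "integrable lborel (\<lambda>y. f x * (G 0 (x - y) * p y))" using int2[of x] by simp
      then show "integrable lborel (\<lambda>y. ?F (x, y))" by (simp add: ac_simps)
    qed
  qed measurable
  from lborel_pair.Fubini_integral[OF this]
  have swap: "(\<integral>y. (\<integral>x. G 0 (x - y) * f x * p y \<partial>lborel) \<partial>lborel) =
      (\<integral>x. (\<integral>y. G 0 (x - y) * f x * p y \<partial>lborel) \<partial>lborel)"
    by simp
  have e1: "(\<integral>x. G 0 (x - y) * f x * p y \<partial>lborel) = green_inv G f y * p y" for y
    by (simp add: green_inv_def)
  have e2: "(\<integral>y. G 0 (x - y) * f x * p y \<partial>lborel) = f x * green_inv G p x" for x
  proof -
    have "(\<integral>y. G 0 (x - y) * f x * p y \<partial>lborel) = (\<integral>y. f x * (G 0 (x - y) * p y) \<partial>lborel)"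
      by (simp add: ac_simps)
    then show ?thesis by (simp add: green_inv_even[where G=G, OF G])
  qed
  show "(\<integral>x. f x * green_inv G p x \<partial>lborel) = (\<integral>y. green_inv G f y * p y \<partial>lborel)"
    using swap unfolding e1 e2 by (rule sym)
qed

text \<open>
  Joint continuity of the convolution in the function, for \<open>L\<^sup>1\<close> convergence of uniformly bounded
  functions, and in the point.
\<close>

lemma green_inv_tendsto:
  fixes G :: "'a::euclidean_space \<Rightarrow> 'a \<Rightarrow> real"
  assumes G: "tame_kernel (G 0)"
    and f: "integrable lborel f" "AE x in lborel. \<bar>f x\<bar> \<le> M"
    and F: "\<And>n. integrable lborel (F n)" "\<And>n. AE x in lborel. \<bar>F n x\<bar> \<le> M"
    and lim: "(\<lambda>n. \<integral>x. \<bar>F n x - f x\<bar> \<partial>lborel) \<longlonglongrightarrow> 0"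
    and Y: "Y \<longlonglongrightarrow> y"
  shows "(\<lambda>n. green_inv G (F n) (Y n)) \<longlonglongrightarrow> green_inv G f y"
proof -
  note [measurable] = tame_kernel_measurable[OF G]
  have [measurable]: "f \<in> borel_measurable borel" "F n \<in> borel_measurable borel" for n using f F by auto
  have M0: "0 \<le> M" 
  proof -
    have "AE x in (lborel :: 'a measure). 0 \<le> M" using f(2) by eventually_elim auto
    then show ?thesis by (simp add: eventually_const_iff ae_filter_eq_bot_iff)
  qed
  define D where "D n z = F n (z + Y n) - f (z + y)" for n z
  have shF: "integrable lborel (\<lambda>z. k (z + c))" if "integrable lborel k" for k :: "'a \<Rightarrow> real" and c
    using integrable_translation[of k c] that by (simp add: add.commute)
  have Di: "integrable lborel (D n)" for n
    unfolding D_def using f F by (intro Bochner_Integration.integrable_diff shF) auto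
  have Db: "AE z in lborel. \<bar>D n z\<bar> \<le> 2 * M" for n
  proof -
    have "AE z in lborel. \<bar>F n (z + Y n)\<bar> \<le> M" using AE_translation[OF F(2)[of n], of "Y n"] by (simp add: add.commute)
    moreover have "AE z in lborel. \<bar>f (z + y)\<bar> \<le> M" using AE_translation[OF f(2), of y] by (simp add: add.commute)
    ultimately show ?thesis unfolding D_def by eventually_elim auto
  qed
  have diff: "green_inv G (F n) (Y n) - green_inv G f y = (\<integral>z. G 0 (z - 0) * D n z \<partial>lborel)" for n
  proof -
    have eq: "green_inv G k c = (\<integral>z. G 0 z * k (z + c) \<partial>lborel)"
      and int: "integrable lborel k \<Longrightarrow> AE x in lborel. \<bar>k x\<bar> \<le> M \<Longrightarrow> integrable lborel (\<lambda>z. G 0 z * k (z + c))" for k c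
    proof -
      show "green_inv G k c = (\<integral>z. G 0 z * k (z + c) \<partial>lborel)"
        using integral_translation[of "\<lambda>x. G 0 (x - c) * k x" c] by (simp add: green_inv_def add.commute)
      show "integrable lborel (\<lambda>z. G 0 z * k (z + c))" if "integrable lborel k" "AE x in lborel. \<bar>k x\<bar> \<le> M"
        using shF[OF kernel_mult_integrable[where G=G, OF G that, of c], of c] by simp
    qed
    show ?thesis unfolding eq D_def
      using int[OF F(1)[of n] F(2)[of n], of "Y n"] int[OF f, of y]
      by (simp add: right_diff_distrib)
  qed
  have Dlim: "(\<lambda>n. \<integral>z. \<bar>D n z\<bar> \<partial>lborel) \<longlonglongrightarrow> 0"
  proof (rule tendsto_sandwich[OF _ _ tendsto_const])
    have "(\<lambda>n. Y n - y) \<longlonglongrightarrow> 0" using Y by (simp add: LIM_zero)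
    from tendsto_add[OF lim L1_translation_tendsto[OF f(1) this]]
    show "(\<lambda>n. (\<integral>x. \<bar>F n x - f x\<bar> \<partial>lborel) + (\<integral>x. \<bar>f (x + (Y n - y)) - f x\<bar> \<partial>lborel)) \<longlonglongrightarrow> 0" by simp
    have "(\<integral>z. \<bar>D n z\<bar> \<partial>lborel) \<le> (\<integral>x. \<bar>F n x - f x\<bar> \<partial>lborel) + (\<integral>x. \<bar>f (x + (Y n - y)) - f x\<bar> \<partial>lborel)" for n
    proof -
      have "(\<integral>z. \<bar>D n z\<bar> \<partial>lborel) \<le> (\<integral>z. \<bar>F n (z + Y n) - f (z + Y n)\<bar> \<partial>lborel) + (\<integral>z. \<bar>f (z + Y n) - f (z + y)\<bar> \<partial>lborel)"
        unfolding D_def by (intro L1_dist_triangle shF f F)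
      also have "(\<integral>z. \<bar>F n (z + Y n) - f (z + Y n)\<bar> \<partial>lborel) = (\<integral>x. \<bar>F n x - f x\<bar> \<partial>lborel)"
        using integral_translation[of "\<lambda>x. \<bar>F n x - f x\<bar>" "Y n"] by (simp add: add.commute)
      also have "(\<integral>z. \<bar>f (z + Y n) - f (z + y)\<bar> \<partial>lborel) = (\<integral>x. \<bar>f (x + (Y n - y)) - f x\<bar> \<partial>lborel)"
        using integral_translation[of "\<lambda>x. \<bar>f (x + (Y n - y)) - f x\<bar>" "y"] by (simp add: add.commute)
      finally show ?thesis .
    qed
    then show "\<forall>\<^sub>F n in sequentially. (\<integral>z. \<bar>D n z\<bar> \<partial>lborel) \<le>
        (\<integral>x. \<bar>F n x - f x\<bar> \<partial>lborel) + (\<integral>x. \<bar>f (x + (Y n - y)) - f x\<bar> \<partial>lborel)" by simp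
  qed simp
  have "(\<lambda>n. green_inv G (F n) (Y n) - green_inv G f y) \<longlonglongrightarrow> 0"
  proof (rule LIMSEQ_I)
    fix r :: real assume r: "0 < r"
    have e: "0 < r / (4 * (M + 1))" using r M0 by simp
    obtain h k where k: "0 \<le> k" and h: "integrable lborel h" "\<And>x. 0 \<le> h x" 
      and he: "(\<integral>x. h x \<partial>lborel) < r / (4 * (M + 1))" and hk: "AE x in lborel. \<bar>G 0 x - h x\<bar> \<le> k"
      by (rule tame_kernel_decomposition[OF G e]) (rule that; simp)
    have "0 < r / (2 * (k + 1))" using r k by simp
    from LIMSEQ_D[OF Dlim this] obtain N where N: "\<And>n. n \<ge> N \<Longrightarrow> norm ((\<integral>z. \<bar>D n z\<bar> \<partial>lborel) - 0) < r / (2 * (k + 1))"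
      by blast
    have "norm (green_inv G (F n) (Y n) - green_inv G f y - 0) < r" if n: "n \<ge> N" for n
    proof -
      have "\<bar>\<integral>z. G 0 (z - 0) * D n z \<partial>lborel\<bar> \<le> k * (\<integral>z. \<bar>D n z\<bar> \<partial>lborel) + 2 * M * (\<integral>x. h x \<partial>lborel)"
        by (rule convolution_bound[OF tame_kernel_measurable[OF G] k h hk Di Db])
      also have "k * (\<integral>z. \<bar>D n z\<bar> \<partial>lborel) \<le> k * (r / (2 * (k + 1)))"
        using N[OF n] k by (intro mult_left_mono) auto
      also have "k * (r / (2 * (k + 1))) < r / 2" using k r by (simp add: field_simps)
      also have "2 * M * (\<integral>x. h x \<partial>lborel) \<le> 2 * M * (r / (4 * (M + 1)))"
        using he M0 by (intro mult_left_mono) auto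
      also have "2 * M * (r / (4 * (M + 1))) \<le> r / 2" using M0 r by (simp add: field_simps)
      finally show ?thesis using diff[of n] by simp
    qed
    then show "\<exists>no. \<forall>n\<ge>no. norm (green_inv G (F n) (Y n) - green_inv G f y - 0) < r" by blast
  qed
  then show ?thesis by (simp add: LIM_zero_iff)
qed


section \<open>Green functions are tame kernels\<close>

lemma green_function_AE:
  assumes "green_function D A G"
  shows "AE x in lborel. 0 \<le> G x0 x \<and> G x0 x = G 0 (x - x0) \<and> G x0 x = G 0 (x0 - x)"
  using assms unfolding green_function_def by blast

lemma green_function_shift:
  assumes "green_function D A G"
  shows "AE x in lborel. G x0 x = G 0 (x - x0)"
  by (rule eventually_mono[OF green_function_AE[OF assms, of x0]]) simp

lemma green_function_integral:
  assumes G: "green_function D A G" and [measurable]: "f \<in> borel_measurable borel"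
  shows "(\<integral>x. f x * G x0 x \<partial>lborel) = green_inv G f x0"
proof -
  have [measurable]: "G y \<in> borel_measurable borel" for y
    using G by (simp add: green_function_def L1_loc_def)
  show ?thesis unfolding green_inv_def
  proof (intro integral_cong_AE)
    show "AE x in lborel. f x * G x0 x = G 0 (x - x0) * f x"
      using green_function_shift[OF G, of x0] by (rule eventually_mono) simp
  qed measurable
qed

text \<open>
  Under the first two conditions \<open>G\<close> is bounded off a ball, hence on the set where it exceeds that
  bound it is dominated by its restriction to the ball; under the other two, \<open>G \<le> G\<^sup>p\<close> where \<open>G\<close>
  exceeds \<open>1\<close>.
\<close>

lemma green_function_tame:
  fixes G :: "'a::euclidean_space \<Rightarrow> 'a \<Rightarrow> real"
  assumes G: "green_function D A G"
    and cond: "green_G1 G \<or> green_G1' G \<or> green_G2 G \<or> green_G3 G"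
  shows "tame_kernel (G 0)"
proof -
  have loc: "L1_loc (G 0)" using G by (simp add: green_function_def)
  then have [measurable]: "G 0 \<in> borel_measurable borel" by (simp add: L1_loc_def)
  have base: "AE x in lborel. 0 \<le> G 0 x \<and> G 0 x = G 0 (- x)"
    by (rule eventually_mono[OF green_function_AE[OF G, of 0]]) simp
  have local: "tame_kernel (G 0)"
    if k: "0 \<le> k" and out: "AE x in lborel. x \<notin> ball x0 1 \<longrightarrow> G x0 x \<le> k" for x0 k
  proof (rule tame_kernelI[OF _ base k])
    have "set_integrable lborel (cball 0 1) (G 0)" using loc by (simp add: L1_loc_def)
    then show "integrable lborel (\<lambda>x. indicator (cball 0 1) x *\<^sub>R G 0 x)" by (simp add: set_integrable_def)
    have "AE x in lborel. x \<notin> ball x0 1 \<longrightarrow> G 0 (x - x0) \<le> k"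
      using out green_function_shift[OF G, of x0] by eventually_elim auto
    from AE_translation[OF this, of x0]
    show "AE x in lborel. k < G 0 x \<longrightarrow> G 0 x \<le> indicator (cball 0 1) x *\<^sub>R G 0 x"
      by (rule eventually_mono) (force simp: indicator_def dist_norm)
  qed measurable
  have global: "tame_kernel (G 0)" if p: "1 \<le> p" and fin: "lnorm (ennreal p) (G 0) < \<infinity>" for p
  proof (rule tame_kernelI[OF _ base zero_le_one])
    have "enn2real (ennreal p) = p" "ennreal p \<noteq> \<infinity>" using p by simp_all
    then have "(\<integral>\<^sup>+x. ennreal (\<bar>G 0 x\<bar> powr p) \<partial>lborel) \<noteq> \<infinity>"
      using fin unfolding lnorm_def Let_def by (intro notI) simp
    then show "integrable lborel (\<lambda>x. \<bar>G 0 x\<bar> powr p)"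
      by (intro integrableI_nonneg) (auto simp: top.not_eq_extremum)
    have "y \<le> \<bar>y\<bar> powr p" if "1 < y" for y :: real
      using powr_mono[of 1 p y] p that by simp
    then show "AE x in lborel. 1 < G 0 x \<longrightarrow> G 0 x \<le> \<bar>G 0 x\<bar> powr p" by simp
  qed measurable
  from cond show ?thesis
  proof (elim disjE)
    assume "green_G1 G"
    then obtain x0 :: 'a and \<alpha> K1 K2 where "0 < K2" and
      "\<And>R. R > 0 \<Longrightarrow> AE x in lborel. x \<notin> ball x0 R \<longrightarrow> G x0 x \<le> K2 * R powr - (real DIM('a) - \<alpha>)"
      unfolding green_G1_def by blast
    from this(1) this(2)[of 1]
    show ?thesis by (intro local[of K2 x0]) auto
  next
    assume "green_G1' G"
    then obtain x0 :: 'a and \<alpha> K1 K2 K3 where "0 < K3" and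
      "\<And>R. R > 0 \<Longrightarrow> AE x in lborel. x \<notin> ball x0 R \<longrightarrow>
        G x0 x \<le> max K3 (K2 * R powr - (real DIM('a) - \<alpha>))"
      unfolding green_G1'_def by blast
    from this(1) this(2)[of 1]
    show ?thesis by (intro local[of "max K3 K2" x0]) auto
  next
    assume "green_G2 G"
    then show ?thesis by (intro global[of 1]) (auto simp: green_G2_def intro: le_less_trans)
  next
    assume "green_G3 G"
    then obtain p C where "1 < p" "lnorm (ennreal p) (G 0) \<le> ennreal C"
      unfolding green_G3_def by blast
    then show ?thesis by (intro global[of p]) (auto intro: le_less_trans)
  qed
qed

section \<open>Rescaling of time\<close>

lemma lborel_time_scaling:
  fixes c :: real
  assumes c: "c \<noteq> 0"
  shows "(lborel :: (real \<times> 'a::euclidean_space) measure) =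
    density (distr lborel borel (\<lambda>(t, x). (c * t, x))) (\<lambda>_. ennreal \<bar>c\<bar>)"
proof -
  \<comment> \<open>Dilation by \<open>c\<close> along the basis vector of the time axis only.\<close>
  define k :: "real \<times> 'a \<Rightarrow> real" where "k j = (if j = (1, 0) then c else 1)" for j
  have T: "0 + (\<Sum>j\<in>Basis. (k j * (x \<bullet> j)) *\<^sub>R j) = (case x of (t, y) \<Rightarrow> (c * t, y))" for x
  proof (rule euclidean_eqI)
    fix b :: "real \<times> 'a" assume "b \<in> Basis"
    then have "(0 + (\<Sum>j\<in>Basis. (k j * (x \<bullet> j)) *\<^sub>R j)) \<bullet> b = k b * (x \<bullet> b)"
      by simp
    also have "\<dots> = (case x of (t, y) \<Rightarrow> (c * t, y)) \<bullet> b"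
      using \<open>b \<in> Basis\<close> by (cases x) (auto simp: k_def Basis_prod_def)
    finally show "(0 + (\<Sum>j\<in>Basis. (k j * (x \<bullet> j)) *\<^sub>R j)) \<bullet> b = (case x of (t, y) \<Rightarrow> (c * t, y)) \<bullet> b" .
  qed
  have kj: "\<bar>k j\<bar> = (if j = (1, 0) then \<bar>c\<bar> else 1)" for j by (simp add: k_def)
  have P: "(\<Prod>j\<in>Basis. \<bar>k j\<bar>) = \<bar>c\<bar>"
    unfolding kj by (subst prod.delta) (auto simp: Basis_prod_def)
  show ?thesis
    using lborel_affine_euclidean[of k "0 :: real \<times> 'a"] c unfolding T P by (simp add: k_def)
qed

lemma measurable_time_scaling [measurable]:
  "(\<lambda>(t, x). (c * t, x)) \<in> borel \<rightarrow>\<^sub>M (borel :: (real \<times> 'a::euclidean_space) measure)"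
  by (simp flip: borel_prod add: case_prod_beta')

lemma
  fixes F :: "real \<times> 'a::euclidean_space \<Rightarrow> real"
  assumes c: "0 < c"
  shows integrable_time_scaling:
      "integrable lborel (\<lambda>(t, x). F (c * t, x)) \<longleftrightarrow> integrable lborel F"
    and integral_time_scaling:
      "(\<integral>p. F p \<partial>lborel) = c * (\<integral>(t, x). F (c * t, x) \<partial>lborel)"
proof -
  have imp: "integrable lborel (\<lambda>(t, x). H (d * t, x))"
    if "integrable lborel H" "0 < d" for H :: "real \<times> 'a \<Rightarrow> real" and d
  proof -
    have [measurable]: "H \<in> borel_measurable borel" using that by auto
    have "integrable (density (distr lborel borel (\<lambda>(t, x). (d * t, x))) (\<lambda>_. ennreal \<bar>d\<bar>)) H"
      using that lborel_time_scaling[of d, where 'a='a] by simp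
    then have "integrable (distr lborel borel (\<lambda>(t, x). (d * t, x))) (\<lambda>p. \<bar>d\<bar> *\<^sub>R H p)"
      by (subst (asm) integrable_density) auto
    then have "integrable (distr lborel borel (\<lambda>(t, x). (d * t, x))) H"
      using that by simp
    then have "integrable lborel (\<lambda>p. H ((\<lambda>(t, x). (d * t, x)) p))"
      by (rule integrable_distr[rotated]) measurable
    then show ?thesis by (simp add: case_prod_beta')
  qed
  show iff: "integrable lborel (\<lambda>(t, x). F (c * t, x)) \<longleftrightarrow> integrable lborel F"
  proof
    assume "integrable lborel (\<lambda>(t, x). F (c * t, x))"
    from imp[OF this, of "1 / c"] c show "integrable lborel F" by simp
  qed (use imp c in blast)
  show "(\<integral>p. F p \<partial>lborel) = c * (\<integral>(t, x). F (c * t, x) \<partial>lborel)"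
  proof (cases "integrable lborel F")
    case True
    then have [measurable]: "F \<in> borel_measurable borel" by auto
    have "(\<integral>p. F p \<partial>lborel) =
        (\<integral>p. F p \<partial>density (distr lborel borel (\<lambda>(t, x). (c * t, x))) (\<lambda>_. ennreal \<bar>c\<bar>))"
      using c lborel_time_scaling[of c, where 'a='a] by simp
    also have "\<dots> = (\<integral>p. c *\<^sub>R F p \<partial>distr lborel borel (\<lambda>(t, x). (c * t, x)))"
      using c by (subst integral_density) auto
    also have "\<dots> = (\<integral>p. c *\<^sub>R F ((\<lambda>(t, x). (c * t, x)) p) \<partial>lborel)"
      by (subst integral_distr) auto
    finally show ?thesis by (simp add: case_prod_beta')
  next
    case False
    then show ?thesis using iff by (simp add: not_integrable_integral_eq)
  qed
qed

lemma AE_scaling: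
  fixes c :: real
  assumes c: "0 < c" and P: "AE p in (lborel :: 'b::euclidean_space measure). P p"
  shows "AE p in lborel. P (c *\<^sub>R p)"
proof -
  have c0: "c \<noteq> 0" using c by simp
  have "AE p in density (distr lborel borel (\<lambda>x::'b. 0 + c *\<^sub>R x)) (\<lambda>_. ennreal (\<bar>c\<bar> ^ DIM('b))). P p"
    using P by (subst (asm) lborel_affine[OF c0, of 0])
  then have "AE p in distr lborel borel (\<lambda>x::'b. 0 + c *\<^sub>R x). P p"
    using c by (subst (asm) AE_density) auto
  from AE_distrD[OF _ this] show ?thesis by simp
qed

section \<open>Scaling of test curves\<close>

lemma lnorm_infinity_cmult_le:
  assumes k: "0 < k"
  shows "lnorm \<infinity> (\<lambda>x. k * f x) \<le> ennreal k * lnorm \<infinity> f"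
proof (cases "lnorm \<infinity> f < \<infinity>")
  case True
  then have m: "(\<lambda>x. ennreal \<bar>f x\<bar>) \<in> borel_measurable lborel"
    by (auto simp: lnorm_def esssup_def split: if_splits)
  have "(\<lambda>x. ennreal k * ennreal \<bar>f x\<bar>) \<in> borel_measurable lborel" using m by measurable
  then have m2: "(\<lambda>x. ennreal \<bar>k * f x\<bar>) \<in> borel_measurable lborel"
    using k by (simp add: abs_mult ennreal_mult)
  have "AE x in lborel. ennreal \<bar>k * f x\<bar> \<le> ennreal k * lnorm \<infinity> f"
  proof -
    have "AE x in lborel. ennreal \<bar>f x\<bar> \<le> lnorm \<infinity> f"
      using esssup_AE[of "\<lambda>x. ennreal \<bar>f x\<bar>" lborel] by (simp add: lnorm_def)
    then show ?thesis
      by (rule eventually_mono) (use k in \<open>simp add: abs_mult ennreal_mult mult_left_mono\<close>)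
  qed
  with m2 show ?thesis by (subst lnorm_def) (auto intro: esssup_I)
next
  case False
  then show ?thesis using k by (simp add: less_top[symmetric] ennreal_mult_top)
qed

lemma set_borel_measurable_time_scaling:
  fixes f :: "real \<Rightarrow> 'a::euclidean_space \<Rightarrow> real"
  assumes c: "0 < c" and "set_borel_measurable borel ({a..b} \<times> UNIV) (\<lambda>(t, x). f t x)"
  shows "set_borel_measurable borel ({a / c..b / c} \<times> UNIV) (\<lambda>(t, x). f (c * t) x)"
proof -
  define H where "H = (\<lambda>p. indicator ({a..b} \<times> UNIV) p *\<^sub>R (case p of (t, x) \<Rightarrow> f t x))"
  have [measurable]: "H \<in> borel_measurable borel"
    using assms(2) by (simp add: H_def set_borel_measurable_def)
  have "(\<lambda>p. H ((\<lambda>(t, x). (c * t, x)) p)) \<in> borel_measurable borel" by measurable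
  moreover have "H ((\<lambda>(t, x). (c * t, x)) p) =
      indicator ({a / c..b / c} \<times> UNIV) p *\<^sub>R (case p of (t, x) \<Rightarrow> f (c * t) x)" for p
    using c by (auto simp: H_def indicator_def field_simps split: prod.splits)
  ultimately show ?thesis by (simp add: set_borel_measurable_def)
qed

lemma filterlim_time_scaling:
  fixes t c a b :: real
  assumes c: "0 < c"
  shows "filterlim (\<lambda>s. s / c) (at (t / c) within {a..b}) (at t within {c * a..c * b})"
  unfolding filterlim_at
proof
  show "((\<lambda>s. s / c) \<longlongrightarrow> t / c) (at t within {c * a..c * b})"
    using c by (intro tendsto_intros) auto
  show "\<forall>\<^sub>F s in at t within {c * a..c * b}. s / c \<in> {a..b} \<and> s / c \<noteq> t / c"
    using c by (auto simp: eventually_at_filter field_simps)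
qed

text \<open>A test curve for the rescaled solution becomes one for the original solution.\<close>

lemma test_curve_time_scaling:
  fixes c a b :: real
  assumes c: "0 < c" and tc: "test_curve a b \<psi> \<psi>'"
  shows "test_curve (c * a) (c * b) (\<lambda>s. \<psi> (s / c)) (\<lambda>s x. (1 / c) * \<psi>' (s / c) x)"
  unfolding test_curve_def
proof (intro conjI ballI)
  have mem: "s / c \<in> {a..b}" if "s \<in> {c * a..c * b}" for s
    using that c by (auto simp: field_simps)
  show "set_borel_measurable borel ({c * a..c * b} \<times> UNIV) (\<lambda>(t, x). \<psi> (t / c) x)"
    using set_borel_measurable_time_scaling[of "1 / c" a b \<psi>] tc c
    by (simp add: test_curve_def mult.commute)
  have "set_borel_measurable borel ({c * a..c * b} \<times> UNIV) (\<lambda>(t, x). \<psi>' (t / c) x)"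
    using set_borel_measurable_time_scaling[of "1 / c" a b \<psi>'] tc c
    by (simp add: test_curve_def mult.commute)
  then have "(\<lambda>p. (1 / c) * (indicator ({c * a..c * b} \<times> UNIV) p *\<^sub>R (case p of (t, x) \<Rightarrow> \<psi>' (t / c) x)))
      \<in> borel_measurable borel"
    unfolding set_borel_measurable_def by measurable
  then show "set_borel_measurable borel ({c * a..c * b} \<times> UNIV) (\<lambda>(t, x). (1 / c) * \<psi>' (t / c) x)"
    by (simp add: set_borel_measurable_def case_prod_beta' mult.left_commute)
  show "\<exists>K. compact K \<and> (\<forall>t\<in>{c * a..c * b}. \<forall>x. x \<notin> K \<longrightarrow> \<psi> (t / c) x = 0 \<and> (1 / c) * \<psi>' (t / c) x = 0)"
  proof -
    obtain K where K: "compact K" "\<And>t x. t \<in> {a..b} \<Longrightarrow> x \<notin> K \<Longrightarrow> \<psi> t x = 0 \<and> \<psi>' t x = 0"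
      using tc by (auto simp: test_curve_def)
    then show ?thesis using mem by (intro exI[of _ K]) auto
  qed
  fix t assume t: "t \<in> {c * a..c * b}"
  have c': "0 < 1 / c" using c by simp
  show "lnorm \<infinity> (\<psi> (t / c)) < \<infinity>" using tc mem[OF t] unfolding test_curve_def by blast
  have "lnorm \<infinity> (\<psi>' (t / c)) < \<infinity>" using tc mem[OF t] unfolding test_curve_def by blast
  then have "ennreal (1 / c) * lnorm \<infinity> (\<psi>' (t / c)) < \<infinity>" by (simp add: ennreal_mult_less_top)
  with lnorm_infinity_cmult_le[OF c'] show "lnorm \<infinity> (\<lambda>x. 1 / c * \<psi>' (t / c) x) < \<infinity>"
    by (rule le_less_trans)
  have squeeze: "((\<lambda>s. lnorm \<infinity> (\<lambda>x. 1 / c * h (s / c) x)) \<longlongrightarrow> 0) (at t within {c * a..c * b})"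
    if "((\<lambda>s. lnorm \<infinity> (h s)) \<longlongrightarrow> 0) (at (t / c) within {a..b})" for h :: "real \<Rightarrow> 'a \<Rightarrow> real"
  proof (rule tendsto_sandwich[OF _ _ tendsto_const])
    have "((\<lambda>s. lnorm \<infinity> (h (s / c))) \<longlongrightarrow> 0) (at t within {c * a..c * b})"
      by (rule filterlim_compose[OF that filterlim_time_scaling[OF c]])
    then have "((\<lambda>s. ennreal (1 / c) * lnorm \<infinity> (h (s / c))) \<longlongrightarrow> ennreal (1 / c) * 0)
        (at t within {c * a..c * b})"
      by (intro ennreal_tendsto_cmult) auto
    then show "((\<lambda>s. ennreal (1 / c) * lnorm \<infinity> (h (s / c))) \<longlongrightarrow> 0) (at t within {c * a..c * b})"
      by simp
  qed (simp, rule always_eventually, rule allI, rule lnorm_infinity_cmult_le[OF c'])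
  have "((\<lambda>s. lnorm \<infinity> (\<lambda>x. (\<psi> s x - \<psi> (t / c) x) / (s - t / c) - \<psi>' (t / c) x)) \<longlongrightarrow> 0)
      (at (t / c) within {a..b})"
    using tc mem[OF t] unfolding test_curve_def by blast
  from squeeze[OF this]
  show "((\<lambda>s. lnorm \<infinity> (\<lambda>x. (\<psi> (s / c) x - \<psi> (t / c) x) / (s - t) - 1 / c * \<psi>' (t / c) x)) \<longlongrightarrow> 0)
      (at t within {c * a..c * b})"
  proof (rule Lim_transform_eventually)
    show "\<forall>\<^sub>F s in at t within {c * a..c * b}.
        lnorm \<infinity> (\<lambda>x. 1 / c * ((\<psi> (s / c) x - \<psi> (t / c) x) / (s / c - t / c) - \<psi>' (t / c) x)) =
        lnorm \<infinity> (\<lambda>x. (\<psi> (s / c) x - \<psi> (t / c) x) / (s - t) - 1 / c * \<psi>' (t / c) x)"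
    proof (rule always_eventually, rule allI, rule arg_cong[where f="lnorm \<infinity>"], rule ext)
      fix s x
      have "s / c - t / c = (s - t) / c" by (simp add: diff_divide_distrib)
      then show "1 / c * ((\<psi> (s / c) x - \<psi> (t / c) x) / (s / c - t / c) - \<psi>' (t / c) x) =
          (\<psi> (s / c) x - \<psi> (t / c) x) / (s - t) - 1 / c * \<psi>' (t / c) x"
        using c by (simp add: right_diff_distrib)
    qed
  qed
  have "((\<lambda>s. lnorm \<infinity> (\<lambda>x. \<psi>' s x - \<psi>' (t / c) x)) \<longlongrightarrow> 0) (at (t / c) within {a..b})"
    using tc mem[OF t] unfolding test_curve_def by blast
  from squeeze[OF this]
  show "((\<lambda>s. lnorm \<infinity> (\<lambda>x. 1 / c * \<psi>' (s / c) x - 1 / c * \<psi>' (t / c) x)) \<longlongrightarrow> 0)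
      (at t within {c * a..c * b})"
    by (simp add: right_diff_distrib)
qed

section \<open>Both formulations of the equation at once\<close>

text \<open>
  For \<open>b = 0\<close> this is the dual form of \<open>\<partial>\<^sub>t u + A (u\<^sup>m) = 0\<close>, for \<open>b = 1\<close> that of
  \<open>\<partial>\<^sub>t u + A (u\<^sup>m) = u\<^sup>m\<close>, where \<open>G\<close> is the Green function of \<open>A\<close>.
\<close>

definition dual_identity ::
  "real \<Rightarrow> ('a::euclidean_space \<Rightarrow> 'a \<Rightarrow> real) \<Rightarrow> real \<Rightarrow> (real \<Rightarrow> 'a \<Rightarrow> real) \<Rightarrow> real \<Rightarrow> real \<Rightarrow> bool"
where
  "dual_identity b G m u \<tau>1 \<tau>2 \<longleftrightarrow>
    (\<forall>\<psi> \<psi>'. test_curve \<tau>1 \<tau>2 \<psi> \<psi>' \<longrightarrow>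
        set_integrable lborel ({\<tau>1..\<tau>2} \<times> UNIV)
          (\<lambda>(t, x). green_inv G (u t) x * \<psi>' t x - u t x powr m * \<psi> t x
                     + b * (u t x powr m * green_inv G (\<psi> t) x)) \<and>
        integrable lborel (\<lambda>x. green_inv G (u \<tau>2) x * \<psi> \<tau>2 x) \<and>
        integrable lborel (\<lambda>x. green_inv G (u \<tau>1) x * \<psi> \<tau>1 x) \<and>
        (LINT (t, x):{\<tau>1..\<tau>2} \<times> UNIV|lborel.
            green_inv G (u t) x * \<psi>' t x - u t x powr m * \<psi> t x
            + b * (u t x powr m * green_inv G (\<psi> t) x))
          = (\<integral>x. green_inv G (u \<tau>2) x * \<psi> \<tau>2 x \<partial>lborel)
            - (\<integral>x. green_inv G (u \<tau>1) x * \<psi> \<tau>1 x \<partial>lborel))"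

definition dual_solution ::
  "real \<Rightarrow> ('a::euclidean_space \<Rightarrow> 'a \<Rightarrow> real) \<Rightarrow> real \<Rightarrow> ('a \<Rightarrow> real) \<Rightarrow> (real \<Rightarrow> 'a \<Rightarrow> real) \<Rightarrow> bool" where
  "dual_solution b G m u0 u \<longleftrightarrow>
    (\<forall>T>0. solution_class m T u0 u \<and>
      (AE (\<tau>1, \<tau>2) in lborel. 0 < \<tau>1 \<and> \<tau>1 \<le> \<tau>2 \<and> \<tau>2 \<le> T \<longrightarrow> dual_identity b G m u \<tau>1 \<tau>2))"

lemma weak_dual_solution_eq: "weak_dual_solution G m = dual_solution 0 G m"
  by (intro ext) (simp add: weak_dual_solution_def weak_dual_solution_on_def dual_solution_def
      dual_identity_def)

lemma weak_dual_solution_resolvent_eq: "weak_dual_solution_resolvent G m = dual_solution 1 G m"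
  by (intro ext) (simp add: weak_dual_solution_resolvent_def weak_dual_solution_resolvent_on_def
      dual_solution_def dual_identity_def)

section \<open>Scaling invariance of the equation\<close>

lemma green_inv_cmult: "green_inv G (\<lambda>x. k * f x) y = k * green_inv G f y"
  by (simp add: green_inv_def mult.left_commute)

lemma dual_identity_scaling:
  fixes u :: "real \<Rightarrow> 'a::euclidean_space \<Rightarrow> real"
  assumes k: "0 < k" and id: "dual_identity b G m u (k powr (m - 1) * \<tau>1) (k powr (m - 1) * \<tau>2)"
  shows "dual_identity b G m (\<lambda>t x. k * u (k powr (m - 1) * t) x) \<tau>1 \<tau>2"
  unfolding dual_identity_def
proof (intro allI impI)
  define c where "c = k powr (m - 1)"
  have c: "0 < c" using k by (simp add: c_def)
  have km: "k powr m = k * c" using k by (simp add: c_def powr_diff)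
  fix \<psi> \<psi>' :: "real \<Rightarrow> 'a \<Rightarrow> real"
  assume "test_curve \<tau>1 \<tau>2 \<psi> \<psi>'"
  from id[folded c_def, unfolded dual_identity_def, rule_format, OF test_curve_time_scaling[OF c this]]
  have int: "set_integrable lborel ({c * \<tau>1..c * \<tau>2} \<times> UNIV)
        (\<lambda>(t, x). green_inv G (u t) x * (1 / c * \<psi>' (t / c) x) - u t x powr m * \<psi> (t / c) x
           + b * (u t x powr m * green_inv G (\<psi> (t / c)) x))"
    and i2: "integrable lborel (\<lambda>x. green_inv G (u (c * \<tau>2)) x * \<psi> \<tau>2 x)"
    and i1: "integrable lborel (\<lambda>x. green_inv G (u (c * \<tau>1)) x * \<psi> \<tau>1 x)"
    and eq: "(LINT (t, x):{c * \<tau>1..c * \<tau>2} \<times> UNIV|lborel.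
          green_inv G (u t) x * (1 / c * \<psi>' (t / c) x) - u t x powr m * \<psi> (t / c) x
            + b * (u t x powr m * green_inv G (\<psi> (t / c)) x)) =
        (\<integral>x. green_inv G (u (c * \<tau>2)) x * \<psi> \<tau>2 x \<partial>lborel)
        - (\<integral>x. green_inv G (u (c * \<tau>1)) x * \<psi> \<tau>1 x \<partial>lborel)"
    using c by simp_all
  define F where "F = (\<lambda>p. indicator ({c * \<tau>1..c * \<tau>2} \<times> UNIV) p *\<^sub>R (case p of (t, x) \<Rightarrow>
      green_inv G (u t) x * (1 / c * \<psi>' (t / c) x) - u t x powr m * \<psi> (t / c) x
           + b * (u t x powr m * green_inv G (\<psi> (t / c)) x)))"
  define F' where "F' = (\<lambda>p. indicator ({\<tau>1..\<tau>2} \<times> UNIV) p *\<^sub>R (case p of (t, x) \<Rightarrow>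
      green_inv G (\<lambda>x. k * u (c * t) x) x * \<psi>' t x - (k * u (c * t) x) powr m * \<psi> t x
           + b * ((k * u (c * t) x) powr m * green_inv G (\<psi> t) x)))"
  have FF': "F' p = (k * c) * (case p of (t, x) \<Rightarrow> F (c * t, x))" for p
  proof (cases p)
    case (Pair t x)
    have "(c * t, x) \<in> {c * \<tau>1..c * \<tau>2} \<times> UNIV \<longleftrightarrow> (t, x) \<in> {\<tau>1..\<tau>2} \<times> UNIV"
      using c by simp
    then have "indicator ({c * \<tau>1..c * \<tau>2} \<times> UNIV) (c * t, x) =
        (indicator ({\<tau>1..\<tau>2} \<times> UNIV) (t, x) :: real)"
      unfolding indicator_def by presburger
    then show ?thesis using c k unfolding F_def F'_def Pair
      by (simp add: green_inv_cmult powr_mult km algebra_simps)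
  qed
  have Fi: "integrable lborel F" using int by (simp add: F_def set_integrable_def)
  have F'i: "integrable lborel F'"
    unfolding FF'[abs_def] using Fi by (intro integrable_mult_right impI) (simp add: integrable_time_scaling[OF c])
  have "(\<integral>p. F' p \<partial>lborel) = k * (c * (\<integral>(t, x). F (c * t, x) \<partial>lborel))"
    unfolding FF' by simp
  also have "\<dots> = k * (\<integral>p. F p \<partial>lborel)" by (simp only: integral_time_scaling[OF c, of F])
  also have "(\<integral>p. F p \<partial>lborel) = (\<integral>x. green_inv G (u (c * \<tau>2)) x * \<psi> \<tau>2 x \<partial>lborel)
        - (\<integral>x. green_inv G (u (c * \<tau>1)) x * \<psi> \<tau>1 x \<partial>lborel)"
    using eq by (simp add: F_def set_lebesgue_integral_def)
  finally have F'eq: "(\<integral>p. F' p \<partial>lborel) =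
      (\<integral>x. green_inv G (\<lambda>x. k * u (c * \<tau>2) x) x * \<psi> \<tau>2 x \<partial>lborel)
        - (\<integral>x. green_inv G (\<lambda>x. k * u (c * \<tau>1) x) x * \<psi> \<tau>1 x \<partial>lborel)"
    by (simp add: green_inv_cmult right_diff_distrib mult.assoc)
  show "set_integrable lborel ({\<tau>1..\<tau>2} \<times> UNIV)
          (\<lambda>(t, x). green_inv G (\<lambda>x. k * u (k powr (m - 1) * t) x) x * \<psi>' t x
             - (k * u (k powr (m - 1) * t) x) powr m * \<psi> t x
             + b * ((k * u (k powr (m - 1) * t) x) powr m * green_inv G (\<psi> t) x)) \<and>
        integrable lborel (\<lambda>x. green_inv G (\<lambda>x. k * u (k powr (m - 1) * \<tau>2) x) x * \<psi> \<tau>2 x) \<and>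
        integrable lborel (\<lambda>x. green_inv G (\<lambda>x. k * u (k powr (m - 1) * \<tau>1) x) x * \<psi> \<tau>1 x) \<and>
        (LINT (t, x):{\<tau>1..\<tau>2} \<times> UNIV|lborel.
            green_inv G (\<lambda>x. k * u (k powr (m - 1) * t) x) x * \<psi>' t x
            - (k * u (k powr (m - 1) * t) x) powr m * \<psi> t x
            + b * ((k * u (k powr (m - 1) * t) x) powr m * green_inv G (\<psi> t) x))
          = (\<integral>x. green_inv G (\<lambda>x. k * u (k powr (m - 1) * \<tau>2) x) x * \<psi> \<tau>2 x \<partial>lborel)
            - (\<integral>x. green_inv G (\<lambda>x. k * u (k powr (m - 1) * \<tau>1) x) x * \<psi> \<tau>1 x \<partial>lborel)"
    unfolding c_def[symmetric] set_integrable_def set_lebesgue_integral_def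
    using F'i F'eq i1 i2
    by (simp add: F'_def) (simp add: green_inv_cmult mult.assoc)
qed

lemma solution_class_scaling:
  fixes u :: "real \<Rightarrow> 'a::euclidean_space \<Rightarrow> real"
  assumes k: "0 < k" and c: "0 < c" and T: "0 < T" and sc: "solution_class m (c * T) u0 u"
  shows "solution_class m T (\<lambda>x. k * u0 x) (\<lambda>t x. k * u (c * t) x)"
  unfolding solution_class_def
proof (intro conjI ballI allI impI)
  have mem: "c * t \<in> {0..c * T}" if "t \<in> {0..T}" for t using that c by auto
  have "set_borel_measurable borel ({0..T} \<times> UNIV) (\<lambda>(t, x). u (c * t) x)"
    using set_borel_measurable_time_scaling[OF c, of 0 "c * T" u] sc c by (simp add: solution_class_def)
  then have "(\<lambda>p. k * (indicator ({0..T} \<times> UNIV) p *\<^sub>R (case p of (t, x) \<Rightarrow> u (c * t) x)))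
      \<in> borel_measurable borel"
    unfolding set_borel_measurable_def by measurable
  then show "set_borel_measurable borel ({0..T} \<times> UNIV) (\<lambda>(t, x). k * u (c * t) x)"
    by (simp add: set_borel_measurable_def case_prod_beta' mult.left_commute)
  show "AE x in lborel. k * u (c * 0) x = k * u0 x"
    using sc by (auto simp: solution_class_def elim!: eventually_mono)
  { fix t assume t: "t \<in> {0..T}"
    have "AE x in lborel. 0 \<le> u (c * t) x" using sc mem[OF t] unfolding solution_class_def by blast
    then show "AE x in lborel. 0 \<le> k * u (c * t) x"
      by (rule eventually_mono) (use k in simp)
    have "integrable lborel (u (c * t))" using sc mem[OF t] unfolding solution_class_def by blast
    then show "integrable lborel (\<lambda>x. k * u (c * t) x)" by simp
    have "((\<lambda>s. \<integral>x. \<bar>u s x - u (c * t) x\<bar> \<partial>lborel) \<longlongrightarrow> 0) (at (c * t) within {0..c * T})"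
      using sc mem[OF t] unfolding solution_class_def by blast
    moreover have "filterlim (\<lambda>s. c * s) (at (c * t) within {0..c * T}) (at t within {0..T})"
      using filterlim_time_scaling[of "1 / c" t 0 "c * T"] c by (simp add: mult.commute)
    ultimately have "((\<lambda>s. \<integral>x. \<bar>u (c * s) x - u (c * t) x\<bar> \<partial>lborel) \<longlongrightarrow> 0) (at t within {0..T})"
      by (rule filterlim_compose)
    from tendsto_mult_right_zero[OF this, of k]
    show "((\<lambda>s. \<integral>x. \<bar>k * u (c * s) x - k * u (c * t) x\<bar> \<partial>lborel) \<longlongrightarrow> 0) (at t within {0..T})"
      using k by (simp flip: right_diff_distrib add: abs_mult)
  }
  fix K :: "'a set" assume K: "compact K"
  define F where "F = (\<lambda>p. indicator ({0<..<c * T} \<times> K) p *\<^sub>R (case p of (t, x) \<Rightarrow> u t x powr m))"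
  have "integrable lborel F"
    using sc K unfolding F_def solution_class_def set_integrable_def by blast
  then have "integrable lborel (\<lambda>(t, x). F (c * t, x))" by (simp add: integrable_time_scaling[OF c])
  then have "integrable lborel (\<lambda>p. k powr m * (case p of (t, x) \<Rightarrow> F (c * t, x)))" by simp
  moreover have "k powr m * (case p of (t, x) \<Rightarrow> F (c * t, x)) =
      indicator ({0<..<T} \<times> K) p *\<^sub>R (case p of (t, x) \<Rightarrow> (k * u (c * t) x) powr m)" for p
    using c k by (auto simp: F_def powr_mult indicator_def zero_less_mult_iff split: prod.splits)
  ultimately show "set_integrable lborel ({0<..<T} \<times> K) (\<lambda>(t, x). (k * u (c * t) x) powr m)"
    by (simp add: set_integrable_def)
qed

proposition dual_solution_scaling:
  fixes u :: "real \<Rightarrow> 'a::euclidean_space \<Rightarrow> real"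
  assumes k: "0 < k" and u: "dual_solution b G m u0 u"
  shows "dual_solution b G m (\<lambda>x. k * u0 x) (\<lambda>t x. k * u (k powr (m - 1) * t) x)"
  unfolding dual_solution_def
proof (intro allI impI conjI)
  fix T :: real assume T: "0 < T"
  define c where "c = k powr (m - 1)"
  have c: "0 < c" using k by (simp add: c_def)
  have cT: "0 < c * T" using c T by simp
  show "solution_class m T (\<lambda>x. k * u0 x) (\<lambda>t x. k * u (k powr (m - 1) * t) x)"
    using u cT unfolding c_def[symmetric] dual_solution_def
    by (intro solution_class_scaling k c T) blast
  have "AE p in lborel. 0 < fst p \<and> fst p \<le> snd p \<and> snd p \<le> c * T \<longrightarrow> dual_identity b G m u (fst p) (snd p)"
    using u cT unfolding dual_solution_def by (simp add: case_prod_beta')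
  from AE_scaling[OF c this]
  show "AE (\<tau>1, \<tau>2) in lborel. 0 < \<tau>1 \<and> \<tau>1 \<le> \<tau>2 \<and> \<tau>2 \<le> T \<longrightarrow>
      dual_identity b G m (\<lambda>t x. k * u (k powr (m - 1) * t) x) \<tau>1 \<tau>2"
  proof (rule eventually_mono, clarify)
    fix \<tau>1 \<tau>2 :: real
    assume *: "0 < fst (c *\<^sub>R (\<tau>1, \<tau>2)) \<and> fst (c *\<^sub>R (\<tau>1, \<tau>2)) \<le> snd (c *\<^sub>R (\<tau>1, \<tau>2)) \<and>
        snd (c *\<^sub>R (\<tau>1, \<tau>2)) \<le> c * T \<longrightarrow>
        dual_identity b G m u (fst (c *\<^sub>R (\<tau>1, \<tau>2))) (snd (c *\<^sub>R (\<tau>1, \<tau>2)))"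
      and t: "0 < \<tau>1" "\<tau>1 \<le> \<tau>2" "\<tau>2 \<le> T"
    show "dual_identity b G m (\<lambda>t x. k * u (k powr (m - 1) * t) x) \<tau>1 \<tau>2"
      by (rule dual_identity_scaling[OF k]) (use * t c in \<open>simp add: c_def[symmetric]\<close>)
  qed
qed

section \<open>Monotonicity in time\<close>

lemma AE_real_dense:
  fixes P :: "real \<Rightarrow> bool"
  assumes P: "AE t in lborel. P t" and ab: "a < b"
  obtains t where "a < t" "t < b" "P t"
proof -
  have "\<exists>t. a < t \<and> t < b \<and> P t"
  proof (rule ccontr)
    assume "\<nexists>t. a < t \<and> t < b \<and> P t"
    then have "AE t in lborel. t \<notin> {a<..<b}" using P by (auto elim!: eventually_mono)
    then have "emeasure lborel {a<..<b} = 0"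
      by (subst (asm) AE_iff_measurable[of "{a<..<b}"]) auto
    then show False using ab by simp
  qed
  then show thesis using that by blast
qed

lemma AE_real_sequence:
  fixes P :: "real \<Rightarrow> bool"
  assumes P: "AE t in lborel. P t"
  obtains s where "\<And>n. a < s n" "\<And>n. P (s n)" "s \<longlonglongrightarrow> a"
proof -
  have "\<exists>t. a < t \<and> t < a + inverse (real (Suc n)) \<and> P t" for n
    using AE_real_dense[OF P, of a "a + inverse (real (Suc n))"] by (metis less_add_same_cancel1 inverse_positive_iff_positive of_nat_0_less_iff zero_less_Suc)
  then obtain s where s: "\<And>n. a < s n" "\<And>n. s n < a + inverse (real (Suc n))" "\<And>n. P (s n)"
    by metis
  have lim: "(\<lambda>n. a + inverse (real (Suc n))) \<longlonglongrightarrow> a + 0"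
    by (intro tendsto_intros LIMSEQ_inverse_real_of_nat)
  have "s \<longlonglongrightarrow> a"
  proof (rule tendsto_sandwich[OF _ _ tendsto_const])
    show "(\<lambda>n. a + inverse (real (Suc n))) \<longlonglongrightarrow> a" using lim by simp
  qed (use s(1,2) in \<open>auto simp: less_imp_le simp del: of_nat_Suc intro!: always_eventually\<close>)
  with s that show thesis by blast
qed

lemma AE_lborel_pair:
  fixes P :: "'b::euclidean_space \<Rightarrow> 'c::euclidean_space \<Rightarrow> bool"
  assumes "AE (x, y) in lborel. P x y"
  shows "AE x in lborel. AE y in lborel. P x y"
proof -
  have "AE q in lborel \<Otimes>\<^sub>M lborel. (case q of (x, y) \<Rightarrow> P x y)"
    using assms unfolding lborel_prod .
  from lborel_pair.AE_pair[OF this] show ?thesis by simp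
qed

lemma AE_le_L1_limit:
  fixes f g :: "'b \<Rightarrow> real"
  assumes int: "integrable M f" "integrable M g" "\<And>n. integrable M (F n)" "\<And>n. integrable M (H n)"
    and le: "\<And>n::nat. AE x in M. F n x \<le> H n x"
    and F: "(\<lambda>n. \<integral>x. \<bar>F n x - f x\<bar> \<partial>M) \<longlonglongrightarrow> 0"
    and H: "(\<lambda>n. \<integral>x. \<bar>H n x - g x\<bar> \<partial>M) \<longlonglongrightarrow> 0"
  shows "AE x in M. f x \<le> g x"
proof -
  have i: "integrable M (\<lambda>x. max 0 (f x - g x))" using int by auto
  have "(\<integral>x. max 0 (f x - g x) \<partial>M) \<le> (\<integral>x. \<bar>F n x - f x\<bar> \<partial>M) + (\<integral>x. \<bar>H n x - g x\<bar> \<partial>M)" for n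
  proof -
    have "(\<integral>x. max 0 (f x - g x) \<partial>M) \<le> (\<integral>x. \<bar>F n x - f x\<bar> + \<bar>H n x - g x\<bar> \<partial>M)"
      by (intro integral_mono_AE i)
         (use int le[of n] in \<open>auto elim!: eventually_mono\<close>)
    then show ?thesis using int by simp
  qed
  then have "(\<integral>x. max 0 (f x - g x) \<partial>M) \<le> 0 + 0"
    by (intro LIMSEQ_le_const[OF tendsto_add[OF F H]]) auto
  then have "(\<integral>x. max 0 (f x - g x) \<partial>M) = 0" by (intro antisym) auto
  then have "AE x in M. max 0 (f x - g x) = 0"
    using integral_nonneg_eq_0_iff_AE[OF i] by simp
  then show ?thesis by (rule eventually_mono) simp
qed

lemma solution_L1_continuous:
  assumes u: "\<And>T. 0 < T \<Longrightarrow> solution_class m T u0 u" and t: "0 \<le> t"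
    and s: "s \<longlonglongrightarrow> t" "\<And>n. 0 \<le> s n"
  shows "(\<lambda>n. \<integral>x. \<bar>u (s n) x - u t x\<bar> \<partial>lborel) \<longlonglongrightarrow> 0"
proof -
  let ?f = "\<lambda>r. \<integral>x. \<bar>u r x - u t x\<bar> \<partial>lborel"
  have "(?f \<longlongrightarrow> 0) (at t within {0..t + 1})"
    using u[of "t + 1"] t unfolding solution_class_def by auto
  then have cont: "continuous (at t within {0..t + 1}) ?f" by (simp add: continuous_within)
  have "\<forall>\<^sub>F n in sequentially. s n < t + 1" using s(1) by (simp add: order_tendsto_iff)
  then have "\<forall>\<^sub>F n in sequentially. s n \<in> {0..t + 1}" by eventually_elim (use s(2) in auto)
  from continuous_within_tendsto_compose[OF cont this s(1)] show ?thesis by simp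
qed

text \<open>
  The comparison of \<open>u\<close> with its rescaling, whose datum \<open>k u0\<close> is larger. The comparison principle
  concerns almost all times only; continuity in \<open>L\<^sup>1\<close> extends the inequality to all of them.
\<close>

proposition solution_time_monotone_scaled:
  fixes u :: "real \<Rightarrow> 'a::euclidean_space \<Rightarrow> real"
  assumes cp: "comparison_principle (dual_solution b G m)" and u0: "initial_datum u0"
    and u: "dual_solution b G m u0 u" and k: "1 \<le> k" and t: "0 < t"
  shows "AE x in lborel. u t x \<le> k * u (k powr (m - 1) * t) x"
proof -
  define c where "c = k powr (m - 1)"
  have c: "0 < c" using k by (simp add: c_def)
  have sc: "solution_class m T u0 u" if "0 < T" for T using u that by (simp add: dual_solution_def)
  have int: "integrable lborel (u r)" if "0 \<le> r" for r
    using sc[of "r + 1"] that unfolding solution_class_def by auto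
  have k0: "0 < k" using k by simp
  have "initial_datum (\<lambda>x. k * u0 x)"
    using u0 k lnorm_infinity_cmult_le[OF k0, of u0] unfolding initial_datum_def
    by (auto elim!: eventually_mono intro: le_less_trans simp: ennreal_mult_less_top)
  moreover have "AE x in lborel. u0 x \<le> k * u0 x"
  proof -
    have "AE x in lborel. 0 \<le> u0 x" using u0 by (simp add: initial_datum_def)
    then show ?thesis
    proof eventually_elim
      case (elim x)
      then show ?case using mult_right_mono[OF k elim] by simp
    qed
  qed
  ultimately have "AE (t, x) in lborel. 0 < t \<longrightarrow> u t x \<le> k * u (c * t) x"
    using cp u0 u dual_solution_scaling[OF k0 u] unfolding comparison_principle_def c_def by blast
  from AE_lborel_pair[OF this]
  have "AE t in lborel. AE x in lborel. 0 < t \<longrightarrow> u t x \<le> k * u (c * t) x" .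
  from AE_real_sequence[OF this, of t] obtain s where s: "\<And>n. t < s n" "s \<longlonglongrightarrow> t"
    and le0: "\<And>n. AE x in lborel. 0 < s n \<longrightarrow> u (s n) x \<le> k * u (c * s n) x" by metis
  have s0: "0 < s n" for n using s(1)[of n] t by simp
  have le: "AE x in lborel. u (s n) x \<le> k * u (c * s n) x" for n
    using le0[of n] s0[of n] by simp
  have "AE x in lborel. u t x \<le> k * u (c * t) x"
  proof (rule AE_le_L1_limit[OF _ _ _ _ le])
    show "(\<lambda>n. \<integral>x. \<bar>u (s n) x - u t x\<bar> \<partial>lborel) \<longlonglongrightarrow> 0"
      using s s0 t by (intro solution_L1_continuous[OF sc]) (auto intro: less_imp_le)
    have "(\<lambda>n. c * s n) \<longlonglongrightarrow> c * t" using s by (intro tendsto_intros)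
    then have "(\<lambda>n. \<integral>x. \<bar>u (c * s n) x - u (c * t) x\<bar> \<partial>lborel) \<longlonglongrightarrow> 0"
      using s0 c t by (intro solution_L1_continuous[OF sc]) (auto intro: less_imp_le)
    from tendsto_mult_right_zero[OF this, of k]
    show "(\<lambda>n. \<integral>x. \<bar>k * u (c * s n) x - k * u (c * t) x\<bar> \<partial>lborel) \<longlonglongrightarrow> 0"
      using k by (simp flip: right_diff_distrib add: abs_mult)
  qed (use int s0 t c in \<open>auto intro!: integrable_mult_right int simp: less_imp_le\<close>)
  then show ?thesis by (simp add: c_def)
qed

lemma solution_time_monotone:
  fixes u :: "real \<Rightarrow> 'a::euclidean_space \<Rightarrow> real"
  assumes cp: "comparison_principle (dual_solution b G m)" and u0: "initial_datum u0"
    and u: "dual_solution b G m u0 u" and m: "1 < m" and t: "0 < t" "t \<le> s"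
  shows "AE x in lborel. u t x powr m \<le> (s / t) powr (m / (m - 1)) * u s x powr m"
proof -
  define k where "k = (s / t) powr (1 / (m - 1))"
  have k: "1 \<le> k" using t m by (simp add: k_def ge_one_powr_ge_zero)
  have km: "k powr (m - 1) * t = s" using t m by (simp add: k_def powr_powr)
  have kp: "k powr m = (s / t) powr (m / (m - 1))" by (simp add: k_def powr_powr)
  have "AE x in lborel. 0 \<le> u t x"
    using u[unfolded dual_solution_def, rule_format, of "t + 1"] t unfolding solution_class_def by auto
  moreover have "AE x in lborel. u t x \<le> k * u s x"
    using solution_time_monotone_scaled[OF cp u0 u k t(1)] by (simp add: km)
  ultimately show ?thesis
  proof eventually_elim
    case (elim x)
    then have "u t x powr m \<le> (k * u s x) powr m" using m by (intro powr_mono2) auto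
    then show ?case by (simp add: powr_mult kp)
  qed
qed

section \<open>The fundamental upper bound\<close>

lemma lnorm_infinity_cmult_indicator:
  fixes B :: "'a::euclidean_space set"
  assumes "B \<in> sets borel"
  shows "lnorm \<infinity> (\<lambda>x. c * indicator B x) \<le> ennreal \<bar>c\<bar>"
proof (rule lnorm_infinity_le)
  show "(\<lambda>x. c * indicator B x) \<in> borel_measurable borel" using assms by measurable
qed (simp add: indicator_def)

lemma test_curve_exponential:
  fixes B :: "'a::euclidean_space set"
  assumes B: "B \<in> sets borel" "bounded B"
  shows "test_curve a b (\<lambda>t x. exp (- L * (t - \<tau>)) * indicator B x)
    (\<lambda>t x. - L * exp (- L * (t - \<tau>)) * indicator B x)"
  unfolding test_curve_def
proof (intro conjI ballI)
  note [measurable] = B(1)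
  let ?e = "\<lambda>t. exp (- L * (t - \<tau>))"
  show "set_borel_measurable borel ({a..b} \<times> UNIV) (\<lambda>(t, x). ?e t * indicator B x)"
    unfolding set_borel_measurable_def borel_prod[symmetric] by measurable
  show "set_borel_measurable borel ({a..b} \<times> UNIV) (\<lambda>(t, x). - L * ?e t * indicator B x)"
    unfolding set_borel_measurable_def borel_prod[symmetric] by measurable
  show "\<exists>K. compact K \<and> (\<forall>t\<in>{a..b}. \<forall>x. x \<notin> K \<longrightarrow>
      ?e t * indicator B x = 0 \<and> - L * ?e t * indicator B x = 0)"
    using B(2) closure_subset[of B] by (intro exI[of _ "closure B"]) (auto simp: indicator_def)
  fix t assume "t \<in> {a..b}"
  note le = lnorm_infinity_cmult_indicator[OF B(1)]
  show "lnorm \<infinity> (\<lambda>x. ?e t * indicator B x) < \<infinity>" "lnorm \<infinity> (\<lambda>x. - L * ?e t * indicator B x) < \<infinity>"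
    by (rule le_less_trans[OF le], simp)+
  have squeeze: "((\<lambda>s. lnorm \<infinity> (\<lambda>x. h s * indicator B x)) \<longlongrightarrow> 0) F"
    if "(h \<longlongrightarrow> 0) F" for h :: "real \<Rightarrow> real" and F
  proof (rule tendsto_sandwich[OF _ _ tendsto_const])
    show "((\<lambda>s. ennreal \<bar>h s\<bar>) \<longlongrightarrow> 0) F"
      using tendsto_ennrealI[OF tendsto_rabs_zero[OF that]] by simp
  qed (use le in auto)
  have "(?e has_field_derivative - L * ?e t) (at t within {a..b})"
    by (auto intro!: derivative_eq_intros)
  then have "((\<lambda>s. (?e s - ?e t) / (s - t) - - L * ?e t) \<longlongrightarrow> 0) (at t within {a..b})"
    by (simp only: has_field_derivative_iff LIM_zero_iff)
  from squeeze[OF this]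
  show "((\<lambda>s. lnorm \<infinity> (\<lambda>x. (?e s * indicator B x - ?e t * indicator B x) / (s - t)
      - - L * ?e t * indicator B x)) \<longlongrightarrow> 0) (at t within {a..b})"
    by (simp only: left_diff_distrib times_divide_eq_left)
  have "((\<lambda>s. - L * ?e s) \<longlongrightarrow> - L * ?e t) (at t within {a..b})"
    by (intro tendsto_intros)
  then have "((\<lambda>s. - L * ?e s - - L * ?e t) \<longlongrightarrow> 0) (at t within {a..b})"
    by (simp only: LIM_zero_iff)
  from squeeze[OF this]
  show "((\<lambda>s. lnorm \<infinity> (\<lambda>x. - L * ?e s * indicator B x - - L * ?e t * indicator B x)) \<longlongrightarrow> 0)
      (at t within {a..b})"
    by (simp only: left_diff_distrib)
qed

lemma integrable_indicator_bounded:
  fixes B :: "'a::euclidean_space set"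
  assumes "B \<in> sets borel" "bounded B"
  shows "integrable lborel (indicator B :: 'a \<Rightarrow> real)"
  using assms(1) emeasure_bounded_finite[OF assms(2)] by simp

lemma integrable_bounded_powr_indicator:
  fixes f :: "'a::euclidean_space \<Rightarrow> real"
  assumes [measurable]: "f \<in> borel_measurable borel" "B \<in> sets borel" and B: "bounded B"
    and f: "AE x in lborel. \<bar>f x\<bar> \<le> M" and m: "0 \<le> m"
  shows "integrable lborel (\<lambda>x. f x powr m * indicator B x)"
proof (rule Bochner_Integration.integrable_bound)
  have "emeasure lborel B < \<infinity>" using B emeasure_bounded_finite by blast
  then show "integrable lborel (\<lambda>x. M powr m * indicator B x)" by simp
  show "AE x in lborel. norm (f x powr m * indicator B x) \<le> norm (M powr m * indicator B x)"
    using f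
  proof (rule eventually_mono)
    fix x assume "\<bar>f x\<bar> \<le> M"
    then have "\<bar>f x\<bar> powr m \<le> M powr m" using m by (intro powr_mono2) auto
    moreover have "f x powr m = \<bar>f x\<bar> powr m" by (auto simp: abs_if uminus_powr_eq)
    ultimately show "norm (f x powr m * indicator B x) \<le> norm (M powr m * indicator B x)"
      by (simp add: indicator_def)
  qed
qed measurable

text \<open>
  The dual identity tested with \<open>exp(-L (t - \<tau>))\<close> times the indicator of \<open>B\<close>. For \<open>b = 0\<close> the
  hypothesis \<open>reaction\<close> holds with \<open>L = 0\<close>.
\<close>

lemma fundamental_integral_bound:
  fixes u :: "real \<Rightarrow> 'a::euclidean_space \<Rightarrow> real"
  assumes G: "tame_kernel (G 0)" and m: "1 < m"
    and cp: "comparison_principle (dual_solution b G m)" and u0: "initial_datum u0"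
    and u: "dual_solution b G m u0 u"
    and L: "0 \<le> L" and \<tau>: "0 < \<tau>" and h: "0 < h" and \<tau>2: "\<tau> + h \<le> \<tau>2"
    and id: "dual_identity b G m u \<tau> \<tau>2"
    and bound: "AE t in lborel. \<tau> \<le> t \<longrightarrow> (AE x in lborel. \<bar>u t x\<bar> \<le> M)"
    and bound\<tau>: "AE x in lborel. \<bar>u \<tau> x\<bar> \<le> M"
    and reaction: "AE t in lborel. \<tau> \<le> t \<longrightarrow> (AE x in lborel. b * u t x powr m \<le> L * u t x)"
    and B[measurable]: "B \<in> sets borel" and bB: "bounded B"
  shows "(LINT t:{\<tau>..\<tau> + h}|lborel. exp (- L * (t - \<tau>))) * (1 + h / \<tau>) powr - (m / (m - 1)) *
      (\<integral>x. u \<tau> x powr m * indicator B x \<partial>lborel)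
    \<le> (\<integral>x. green_inv G (u \<tau>) x * indicator B x \<partial>lborel)"
proof -
  define e where "e t = exp (- L * (t - \<tau>))" for t
  define \<kappa> where "\<kappa> = (1 + h / \<tau>) powr - (m / (m - 1))"
  define p where "p = (indicator B :: 'a \<Rightarrow> real)"
  define J where "J = {\<tau>..\<tau>2}"
  have [measurable]: "p \<in> borel_measurable borel" "e \<in> borel_measurable borel"
    by (simp_all add: p_def e_def[abs_def])
  have p01: "0 \<le> p x" "p x \<le> 1" for x by (simp_all add: p_def indicator_def)
  have e01: "0 < e t" "\<tau> \<le> t \<Longrightarrow> e t \<le> 1" for t using L by (auto simp: e_def)
  have sc: "solution_class m T u0 u" if "0 < T" for T using u that by (simp add: dual_solution_def)
  have int: "integrable lborel (u r)" and nonneg: "AE x in lborel. 0 \<le> u r x" if "0 \<le> r" for r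
    using sc[of "r + 1"] that unfolding solution_class_def by auto
  have umeas: "u r \<in> borel_measurable borel" if "0 \<le> r" for r using int[OF that] by auto
  have pint: "integrable lborel p" unfolding p_def
    by (rule integrable_indicator_bounded[OF B bB])
  have pbd: "AE x in lborel. \<bar>p x\<bar> \<le> 1" by (auto simp: p_def indicator_def)
  have Gp0: "0 \<le> green_inv G p x" for x by (rule green_inv_nonneg[where G=G, OF G]) (simp add: p01)

  \<comment> \<open>\<open>F\<close> is the integrand of the dual identity; \<open>E\<close> below is its diffusion term with the sign reversed.\<close>
  define F where "F = (\<lambda>(t, x). indicator J t * (green_inv G (u t) x * (- L * e t * p x)
      - u t x powr m * (e t * p x) + b * (u t x powr m * (e t * green_inv G p x))))"
  have F: "integrable lborel F"
    and Feq: "(\<integral>q. F q \<partial>lborel) = (\<integral>x. green_inv G (u \<tau>2) x * (e \<tau>2 * p x) \<partial>lborel)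
            - (\<integral>x. green_inv G (u \<tau>) x * p x \<partial>lborel)"
  proof -
    have Fform: "F = (\<lambda>q. indicator ({\<tau>..\<tau>2} \<times> UNIV) q *\<^sub>R (case q of (t, x) \<Rightarrow>
      green_inv G (u t) x * (- L * e t * p x) - u t x powr m * (e t * p x)
        + b * (u t x powr m * green_inv G (\<lambda>x. e t * p x) x)))"
      by (auto simp: F_def fun_eq_iff green_inv_cmult J_def indicator_times)
    have tc: "test_curve \<tau> \<tau>2 (\<lambda>t x. e t * p x) (\<lambda>t x. - L * e t * p x)"
      unfolding e_def p_def by (rule test_curve_exponential[OF B bB])
    note I = id[unfolded dual_identity_def, rule_format, OF tc]
    show "integrable lborel F" using I unfolding Fform set_integrable_def by blast
    have "e \<tau> = 1" by (simp add: e_def)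
    with I show "(\<integral>q. F q \<partial>lborel) = (\<integral>x. green_inv G (u \<tau>2) x * (e \<tau>2 * p x) \<partial>lborel)
            - (\<integral>x. green_inv G (u \<tau>) x * p x \<partial>lborel)"
      unfolding Fform set_lebesgue_integral_def by simp
  qed

  define E where "E = (\<lambda>(t, x). indicator J t * (e t * (u t x powr m * p x)))"
  have E: "integrable lborel E"
  proof -
    obtain K where K: "compact K" "B \<subseteq> K"
      using bB by (meson bounded_subset_cball compact_cball)
    have "0 < \<tau>2 + 1" using \<tau> h \<tau>2 by simp
    from sc[OF this] K(1) have *: "integrable lborel
        (\<lambda>q. indicator ({0<..<\<tau>2 + 1} \<times> K) q *\<^sub>R (case q of (t, x) \<Rightarrow> u t x powr m))"
      unfolding solution_class_def set_integrable_def by blast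
    have [measurable]: "(\<lambda>q. indicator J (fst q) * (e (fst q) * p (snd q))) \<in> borel_measurable lborel"
      unfolding J_def borel_prod[symmetric] by (simp add: borel_prod[symmetric]) measurable
    have "integrable lborel (\<lambda>q. (indicator ({0<..<\<tau>2 + 1} \<times> K) q *\<^sub>R (case q of (t, x) \<Rightarrow> u t x powr m))
        * (indicator J (fst q) * (e (fst q) * p (snd q))))"
    proof (rule integrable_mult_bounded[OF *, where C=1])
      fix q :: "real \<times> 'a"
      show "\<bar>indicator J (fst q) * (e (fst q) * p (snd q))\<bar> \<le> 1"
        using e01[of "fst q"] p01[of "snd q"]
        by (auto simp: indicator_def J_def abs_mult intro!: mult_le_one)
    qed measurable
    moreover have "(indicator ({0<..<\<tau>2 + 1} \<times> K) q *\<^sub>R (case q of (t, x) \<Rightarrow> u t x powr m))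
        * (indicator J (fst q) * (e (fst q) * p (snd q))) = E q" for q
      using K(2) \<tau> by (cases q) (auto simp: E_def J_def p_def indicator_def)
    ultimately show ?thesis by simp
  qed

  \<comment> \<open>At each time the reaction term is absorbed by the derivative of the exponential weight: by the
    symmetry of the convolution, both are integrals of \<open>u\<close> against \<open>G * p\<close>.\<close>
  have FE: "(\<integral>q. F q + E q \<partial>lborel) \<le> 0"
  proof -
    have FEi: "integrable (lborel \<Otimes>\<^sub>M lborel) (\<lambda>q. F q + E q)" using F E by (simp add: lborel_prod)
    have "(\<integral>q. F q + E q \<partial>lborel) = (\<integral>t. (\<integral>x. F (t, x) + E (t, x) \<partial>lborel) \<partial>lborel)"
      using lborel_pair.integral_fst'[OF FEi] by (simp add: lborel_prod)
    also have "\<dots> \<le> (\<integral>t. 0 \<partial>(lborel :: real measure))"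
    proof (rule integral_mono_AE)
      show "integrable lborel (\<lambda>t. \<integral>x. F (t, x) + E (t, x) \<partial>lborel)"
        using lborel_pair.integrable_fst'[OF FEi] by simp
      show "AE t in lborel. (\<integral>x. F (t, x) + E (t, x) \<partial>lborel) \<le> 0"
        using bound reaction
      proof eventually_elim
        case (elim t)
        show ?case
        proof (cases "t \<in> J")
          case False
          then show ?thesis by (simp add: F_def E_def)
        next
          case True
          then have t: "\<tau> \<le> t" "0 \<le> t" using \<tau> by (auto simp: J_def)
          have ub: "AE x in lborel. \<bar>u t x\<bar> \<le> M" using elim t by auto
          have re: "AE x in lborel. b * u t x powr m \<le> L * u t x" using elim t by auto
          note sym = green_inv_integral_symmetric[where G=G, OF G int[OF t(2)] ub pint pbd]
          have eq: "F (t, x) + E (t, x) = e t * (b * u t x powr m * green_inv G p x - L * (green_inv G (u t) x * p x))" for x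
            using True by (simp add: F_def E_def algebra_simps)
          have i: "integrable lborel (\<lambda>x. e t * (L * (u t x * green_inv G p x) - L * (green_inv G (u t) x * p x)))"
            using sym by simp
          show ?thesis
          proof (cases "integrable lborel (\<lambda>x. F (t, x) + E (t, x))")
            case False
            then show ?thesis by (simp add: not_integrable_integral_eq)
          next
            case True
            then have "(\<integral>x. F (t, x) + E (t, x) \<partial>lborel) \<le>
                (\<integral>x. e t * (L * (u t x * green_inv G p x) - L * (green_inv G (u t) x * p x)) \<partial>lborel)"
            proof (rule integral_mono_AE[OF _ i])
              show "AE x in lborel. F (t, x) + E (t, x) \<le>
                  e t * (L * (u t x * green_inv G p x) - L * (green_inv G (u t) x * p x))"
                using re
              proof eventually_elim
                case (elim x)
                have "b * u t x powr m * green_inv G p x \<le> L * u t x * green_inv G p x"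
                  using elim Gp0 by (rule mult_right_mono)
                then show ?case unfolding eq using e01(1)[of t] by (simp add: mult.assoc)
              qed
            qed
            also have "\<dots> = 0" using sym by simp
            finally show ?thesis .
          qed
        qed
      qed
    qed simp
    finally show ?thesis by simp
  qed

  have low: "(LINT t:{\<tau>..\<tau> + h}|lborel. e t) * \<kappa> * (\<integral>x. u \<tau> x powr m * p x \<partial>lborel) \<le> (\<integral>q. E q \<partial>lborel)"
  proof -
    have Ei: "integrable (lborel \<Otimes>\<^sub>M lborel) E" using E by (simp add: lborel_prod)
    define I where "I = (\<integral>x. u \<tau> x powr m * p x \<partial>lborel)"
    have uti: "integrable lborel (\<lambda>x. u \<tau> x powr m * p x)"
      unfolding p_def by (rule integrable_bounded_powr_indicator[OF umeas B bB bound\<tau>]) (use \<tau> m in auto)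
    have "set_integrable lborel {\<tau>..\<tau> + h} e"
      unfolding e_def by (intro borel_integrable_atLeastAtMost') (auto intro!: continuous_intros)
    then have ei: "integrable lborel (\<lambda>t. indicator {\<tau>..\<tau> + h} t * e t)" by (simp add: set_integrable_def)
    have "(LINT t:{\<tau>..\<tau> + h}|lborel. e t) * \<kappa> * I = (\<integral>t. (indicator {\<tau>..\<tau> + h} t * e t) * (\<kappa> * I) \<partial>lborel)"
      by (simp add: set_lebesgue_integral_def)
    also have "\<dots> \<le> (\<integral>t. (\<integral>x. E (t, x) \<partial>lborel) \<partial>lborel)"
    proof (rule integral_mono_AE)
      show "integrable lborel (\<lambda>t. indicator {\<tau>..\<tau> + h} t * e t * (\<kappa> * I))"
        using ei by (rule integrable_mult_left)
      show "integrable lborel (\<lambda>t. \<integral>x. E (t, x) \<partial>lborel)"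
        using lborel_pair.integrable_fst'[OF Ei] by simp
      show "AE t in lborel. indicator {\<tau>..\<tau> + h} t * e t * (\<kappa> * I) \<le> (\<integral>x. E (t, x) \<partial>lborel)"
        using lborel_pair.AE_integrable_fst'[OF Ei]
      proof eventually_elim
        case (elim t)
        show ?case
        proof (cases "t \<in> {\<tau>..\<tau> + h}")
          case False
          have "0 \<le> (\<integral>x. E (t, x) \<partial>lborel)"
            by (rule Bochner_Integration.integral_nonneg) (simp add: E_def p01 e01 less_imp_le)
          then show ?thesis using False by simp
        next
          case True
          then have J: "t \<in> J" using \<tau>2 by (simp add: J_def)
          have "indicator {\<tau>..\<tau> + h} t * e t * (\<kappa> * I) = (\<integral>x. e t * \<kappa> * (u \<tau> x powr m * p x) \<partial>lborel)"
            using True by (simp add: I_def)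
          also have "\<dots> \<le> (\<integral>x. E (t, x) \<partial>lborel)"
          proof (rule integral_mono_AE[OF _ elim])
            show "integrable lborel (\<lambda>x. e t * \<kappa> * (u \<tau> x powr m * p x))" using uti by simp
            have "\<tau> \<le> t" using True by simp
            from solution_time_monotone[OF cp u0 u m \<tau> this]
            show "AE x in lborel. e t * \<kappa> * (u \<tau> x powr m * p x) \<le> E (t, x)"
            proof eventually_elim
              case (elim x)
              have q: "0 \<le> m / (m - 1)" using m by simp
              have "t / \<tau> \<le> 1 + h / \<tau>" using True \<tau> by (simp add: field_simps)
              then have "(t / \<tau>) powr (m / (m - 1)) \<le> (1 + h / \<tau>) powr (m / (m - 1))"
                using q True \<tau> by (intro powr_mono2) auto
              then have "u \<tau> x powr m \<le> (1 + h / \<tau>) powr (m / (m - 1)) * u t x powr m"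
                using elim by (meson mult_right_mono order_trans powr_ge_zero)
              then have "\<kappa> * u \<tau> x powr m \<le> \<kappa> * ((1 + h / \<tau>) powr (m / (m - 1)) * u t x powr m)"
                unfolding \<kappa>_def by (intro mult_left_mono) auto
              also have "\<dots> = u t x powr m"
              proof -
                have "0 < 1 + h / \<tau>" using \<tau> h by (simp add: add_pos_pos)
                then have "\<kappa> * (1 + h / \<tau>) powr (m / (m - 1)) = 1"
                  unfolding \<kappa>_def by (simp flip: powr_add)
                then show ?thesis by (simp flip: mult.assoc)
              qed
              finally have "e t * p x * (\<kappa> * u \<tau> x powr m) \<le> e t * p x * u t x powr m"
                using e01(1)[of t] p01(1)[of x] by (intro mult_left_mono) auto
              then show ?case using J by (simp add: E_def mult_ac)
            qed
          qed
          finally show ?thesis .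
        qed
      qed
    qed
    also have "\<dots> = (\<integral>q. E q \<partial>lborel)"
      using lborel_pair.integral_fst'[OF Ei] by (simp add: lborel_prod)
    finally show ?thesis by (simp add: I_def)
  qed
  have "0 \<le> (\<integral>x. green_inv G (u \<tau>2) x * (e \<tau>2 * p x) \<partial>lborel)"
    using green_inv_nonneg[where G=G, OF G nonneg[of \<tau>2]] e01(1)[of \<tau>2] p01 \<tau> h \<tau>2
    by (intro Bochner_Integration.integral_nonneg) simp
  moreover have "(\<integral>q. F q + E q \<partial>lborel) = (\<integral>q. F q \<partial>lborel) + (\<integral>q. E q \<partial>lborel)"
    using F E by (rule Bochner_Integration.integral_add)
  ultimately show ?thesis
    using low FE Feq unfolding e_def p_def \<kappa>_def by linarith
qed

proposition fundamental_pointwise_bound: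
  fixes u :: "real \<Rightarrow> 'a::euclidean_space \<Rightarrow> real"
  assumes G: "tame_kernel (G 0)" and m: "1 < m"
    and cp: "comparison_principle (dual_solution b G m)" and u0: "initial_datum u0"
    and u: "dual_solution b G m u0 u"
    and L: "0 \<le> L" and \<tau>: "0 < \<tau>" and h: "0 < h"
    and id: "AE \<tau>2 in lborel. \<tau> \<le> \<tau>2 \<longrightarrow> dual_identity b G m u \<tau> \<tau>2"
    and bound: "AE t in lborel. \<tau> \<le> t \<longrightarrow> (AE x in lborel. \<bar>u t x\<bar> \<le> M)"
    and bound\<tau>: "AE x in lborel. \<bar>u \<tau> x\<bar> \<le> M"
    and reaction: "AE t in lborel. \<tau> \<le> t \<longrightarrow> (AE x in lborel. b * u t x powr m \<le> L * u t x)"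
  shows "AE x in lborel. (LINT t:{\<tau>..\<tau> + h}|lborel. exp (- L * (t - \<tau>))) *
      (1 + h / \<tau>) powr - (m / (m - 1)) * u \<tau> x powr m \<le> green_inv G (u \<tau>) x"
proof -
  define W where "W = (LINT t:{\<tau>..\<tau> + h}|lborel. exp (- L * (t - \<tau>))) * (1 + h / \<tau>) powr - (m / (m - 1))"
  \<comment> \<open>The final time must be generic, so it cannot be \<open>\<tau> + h\<close> itself.\<close>
  obtain \<tau>2 where \<tau>2: "\<tau> + h < \<tau>2" "\<tau> \<le> \<tau>2 \<longrightarrow> dual_identity b G m u \<tau> \<tau>2"
    by (rule AE_real_dense[OF id, of "\<tau> + h" "\<tau> + h + 1"]) auto
  then have id2: "dual_identity b G m u \<tau> \<tau>2" "\<tau> + h \<le> \<tau>2" using h by auto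
  have ui: "integrable lborel (u \<tau>)"
    using u[unfolded dual_solution_def, rule_format, of "\<tau> + 1"] \<tau> unfolding solution_class_def by auto
  then have [measurable]: "u \<tau> \<in> borel_measurable borel" by auto
  have [measurable]: "green_inv G (u \<tau>) \<in> borel_measurable borel"
    by (rule green_inv_measurable[where G=G, OF G]) measurable
  \<comment> \<open>The bounded parts of the set where the claim fails are admissible in the integral bound, so they
    are null sets.\<close>
  define B where "B n = {x. green_inv G (u \<tau>) x < W * u \<tau> x powr m} \<inter> ball 0 (real n)" for n
  have [measurable]: "B n \<in> sets borel" for n unfolding B_def by measurable
  have bB: "bounded (B n)" for n unfolding B_def by (meson bounded_ball bounded_subset inf_le2)
  have "AE x in lborel. x \<notin> B n" for n
  proof -
    have i1: "integrable lborel (\<lambda>x. u \<tau> x powr m * indicator (B n) x)"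
      by (rule integrable_bounded_powr_indicator[OF _ _ bB bound\<tau>]) (use m in auto)
    have "integrable lborel (indicator (B n) :: 'a \<Rightarrow> real)"
      by (rule integrable_indicator_bounded[OF _ bB]) measurable
    then have i2: "integrable lborel (\<lambda>x. green_inv G (u \<tau>) x * indicator (B n) x)"
      by (rule green_inv_integral_symmetric(2)[where G=G, OF G ui bound\<tau>, where N=1])
         (rule AE_I2, simp add: indicator_def)
    let ?d = "\<lambda>x. W * (u \<tau> x powr m * indicator (B n) x) - green_inv G (u \<tau>) x * indicator (B n) x"
    have i: "integrable lborel ?d" using i1 i2 by simp
    have d0: "0 \<le> ?d x" for x by (auto simp: B_def indicator_def)
    have "(\<integral>x. ?d x \<partial>lborel) \<le> 0"
      using fundamental_integral_bound[OF G m cp u0 u L \<tau> h id2(2,1) bound bound\<tau> reaction _ bB[of n]] i1 i2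
      by (simp add: W_def)
    then have "(\<integral>x. ?d x \<partial>lborel) = 0" using d0 by (intro antisym Bochner_Integration.integral_nonneg) auto
    then have "AE x in lborel. ?d x = 0"
      using integral_nonneg_eq_0_iff_AE[OF i] d0 by auto
    then show ?thesis by (rule eventually_mono) (auto simp: B_def)
  qed
  then have "AE x in lborel. \<forall>n. x \<notin> B n" by (simp add: AE_all_countable)
  then have "AE x in lborel. W * u \<tau> x powr m \<le> green_inv G (u \<tau>) x"
  proof (rule eventually_mono)
    fix x :: 'a assume *: "\<forall>n. x \<notin> B n"
    obtain n :: nat where "norm x < real n" using reals_Archimedean2 by blast
    with * show "W * u \<tau> x powr m \<le> green_inv G (u \<tau>) x"
      by (auto simp: B_def not_less dest: spec[of _ n])
  qed
  then show ?thesis by (simp add: W_def)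
qed

section \<open>Lebesgue points\<close>

text \<open>
  If the averages of \<open>f \<ge> 0\<close> over the balls around \<open>z\<close> tend to \<open>0\<close> and \<open>P\<close> holds almost everywhere,
  then \<open>f\<close> is small at some point of \<open>P\<close>, which may even be taken from the ball of half the radius
  about \<open>z + (r / 2) e\<close>, as this ball carries a fixed fraction of the measure. That \<open>P\<close> holds almost
  everywhere is expressed by the monotonicity of the integral: in space-time \<open>P\<close> is only known to
  hold at almost all points of almost all time slices, and it need not be measurable.
\<close>

lemma ball_average_select:
  fixes f :: "'b::euclidean_space \<Rightarrow> real"
  assumes f0: "\<And>w. 0 \<le> f w" and R: "0 < R" and int: "set_integrable lborel (ball z R) f"
    and lim: "((\<lambda>r. ball_average f z r) \<longlongrightarrow> 0) (at_right 0)" and e: "norm e \<le> 1"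
    and P: "\<And>g h :: 'b \<Rightarrow> real. integrable lborel g \<Longrightarrow> integrable lborel h \<Longrightarrow> (\<And>w. P w \<Longrightarrow> g w \<le> h w) \<Longrightarrow>
        (\<integral>w. g w \<partial>lborel) \<le> (\<integral>w. h w \<partial>lborel)"
    and \<delta>: "0 < \<delta>"
  obtains r w where "0 < r" "r < \<delta>" "w \<in> ball (z + (r / 2) *\<^sub>R e) (r / 2)" "w \<in> ball z r" "P w" "f w < \<delta>"
proof -
  let ?n = "DIM('b)"
  have "\<forall>\<^sub>F r in at_right 0. ball_average f z r < \<delta> / 2 ^ ?n"
    using lim \<delta> by (intro order_tendstoD(2)) auto
  moreover have "\<forall>\<^sub>F r in at_right (0::real). 0 < r \<and> r < min \<delta> R"
    using \<delta> R by (auto intro!: eventually_at_rightI[of 0 "min \<delta> R"])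
  ultimately have "\<forall>\<^sub>F r in at_right 0. ball_average f z r < \<delta> / 2 ^ ?n \<and> 0 < r \<and> r < min \<delta> R"
    by eventually_elim auto
  then obtain r where r: "ball_average f z r < \<delta> / 2 ^ ?n" "0 < r" "r < \<delta>" "r < R"
    by (auto dest!: eventually_happens simp: trivial_limit_at_right_real)
  define B where "B = ball (z + (r / 2) *\<^sub>R e) (r / 2)"
  have sub: "B \<subseteq> ball z r"
  proof
    fix w assume "w \<in> B"
    then have "dist (z + (r / 2) *\<^sub>R e) w < r / 2" by (simp add: B_def)
    moreover have "dist z (z + (r / 2) *\<^sub>R e) \<le> r / 2"
      using e r(2) by (simp add: dist_norm mult_left_le)
    ultimately have "dist z w < r / 2 + r / 2"
      using dist_triangle[of z w "z + (r / 2) *\<^sub>R e"] by linarith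
    then show "w \<in> ball z r" by simp
  qed
  have mB: "measure lborel B = measure lborel (ball z r) / 2 ^ ?n"
    using content_ball_conv_unit_ball[of "r / 2" "z + (r / 2) *\<^sub>R e"] content_ball_conv_unit_ball[of r z] r(2)
    by (simp add: B_def power_divide)
  have pos: "0 < measure lborel (ball z r)" using content_ball_pos[OF r(2), of z] by simp
  have "\<exists>w\<in>B. P w \<and> f w < \<delta>"
  proof (rule ccontr)
    assume neg: "\<not> (\<exists>w\<in>B. P w \<and> f w < \<delta>)"
    have i1: "integrable lborel (\<lambda>w. \<delta> * indicator B w)"
      unfolding B_def by (intro integrable_mult_right integrable_indicator_bounded) auto
    have "set_integrable lborel (ball z r) f"
      by (rule set_integrable_subset[OF int]) (use r in \<open>auto intro: less_trans\<close>)
    then have i2: "integrable lborel (\<lambda>w. indicator (ball z r) w *\<^sub>R f w)" by (simp add: set_integrable_def)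
    have "(\<integral>w. \<delta> * indicator B w \<partial>lborel) \<le> (\<integral>w. indicator (ball z r) w *\<^sub>R f w \<partial>lborel)"
      using neg sub f0 by (intro P[OF i1 i2]) (force simp: indicator_def not_less)
    then have "\<delta> * measure lborel B \<le> (LINT w:ball z r|lborel. f w)"
      by (simp add: set_lebesgue_integral_def B_def)
    then have "\<delta> * measure lborel (ball z r) / 2 ^ ?n \<le> (LINT w:ball z r|lborel. f w)"
      by (simp add: mB)
    then have "\<delta> / 2 ^ ?n \<le> ball_average f z r"
      unfolding ball_average_def using pos by (simp add: field_simps)
    with r(1) show False by simp
  qed
  then obtain w where "w \<in> B" "P w" "f w < \<delta>" by blast
  with that[of r w] r sub show thesis unfolding B_def by blast
qed

lemma integral_mono_iterated_AE:
  fixes g h :: "'b::euclidean_space \<times> 'c::euclidean_space \<Rightarrow> real"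
  assumes "integrable lborel g" "integrable lborel h"
    and le: "AE s in lborel. AE x in lborel. g (s, x) \<le> h (s, x)"
  shows "(\<integral>w. g w \<partial>lborel) \<le> (\<integral>w. h w \<partial>lborel)"
proof -
  have i: "integrable (lborel \<Otimes>\<^sub>M lborel) g" "integrable (lborel \<Otimes>\<^sub>M lborel) h"
    using assms(1,2) unfolding lborel_prod .
  have "(\<integral>s. (\<integral>x. g (s, x) \<partial>lborel) \<partial>lborel) \<le> (\<integral>s. (\<integral>x. h (s, x) \<partial>lborel) \<partial>lborel)"
  proof (intro integral_mono_AE lborel_pair.integrable_fst' i)
    show "AE s in lborel. (\<integral>x. g (s, x) \<partial>lborel) \<le> (\<integral>x. h (s, x) \<partial>lborel)"
      using le lborel_pair.AE_integrable_fst'[OF i(1)] lborel_pair.AE_integrable_fst'[OF i(2)]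
      by eventually_elim (rule integral_mono_AE)
  qed
  then show ?thesis
    using lborel_pair.integral_fst'[OF i(1)] lborel_pair.integral_fst'[OF i(2)]
    unfolding lborel_prod by simp
qed

lemma solution_locally_integrable:
  fixes u :: "real \<Rightarrow> 'a::euclidean_space \<Rightarrow> real"
  assumes m: "1 < m" and u: "solution_class m T u0 u" and S: "S \<subseteq> {0<..<T} \<times> K" "S \<in> sets borel"
    and K: "compact K"
  shows "set_integrable lborel S (\<lambda>(s, y). \<bar>u s y - c\<bar>)"
  unfolding set_integrable_def
proof (rule Bochner_Integration.integrable_bound)
  have "bounded S"
  proof (rule bounded_subset)
    show "bounded ({0..T} \<times> K)" using K by (intro compact_imp_bounded compact_Times compact_Icc)
    show "S \<subseteq> {0..T} \<times> K" using S(1) by force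
  qed
  then have "integrable lborel (indicator S :: real \<times> 'a \<Rightarrow> real)"
    using S(2) by (intro integrable_indicator_bounded)
  moreover have "integrable lborel (\<lambda>q. indicator ({0<..<T} \<times> K) q *\<^sub>R (case q of (t, x) \<Rightarrow> u t x powr m))"
    using u K unfolding solution_class_def set_integrable_def by blast
  ultimately show "integrable lborel (\<lambda>q. (1 + \<bar>c\<bar>) * indicator S q +
      indicator ({0<..<T} \<times> K) q *\<^sub>R (case q of (t, x) \<Rightarrow> u t x powr m))"
    by (intro Bochner_Integration.integrable_add integrable_mult_right)
  have [measurable]: "(\<lambda>q. indicator ({0..T} \<times> UNIV) q *\<^sub>R (case q of (t, x) \<Rightarrow> u t x)) \<in> borel_measurable borel"
    using u by (simp add: solution_class_def set_borel_measurable_def)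
  have [measurable]: "S \<in> sets borel" by fact
  have meas: "(\<lambda>q. indicator S q * \<bar>indicator ({0..T} \<times> UNIV) q *\<^sub>R (case q of (t, x) \<Rightarrow> u t x) - c\<bar>) \<in> borel_measurable lborel"
    by measurable
  have eq: "indicator S q *\<^sub>R (case q of (s, y) \<Rightarrow> \<bar>u s y - c\<bar>) =
      indicator S q * \<bar>indicator ({0..T} \<times> UNIV) q *\<^sub>R (case q of (t, x) \<Rightarrow> u t x) - c\<bar>" for q
    using S(1) by (cases q) (force simp: indicator_def)
  show "(\<lambda>q. indicator S q *\<^sub>R (case q of (s, y) \<Rightarrow> \<bar>u s y - c\<bar>)) \<in> borel_measurable lborel"
    unfolding eq by (rule meas)
  show "AE q in lborel. norm (indicator S q *\<^sub>R (case q of (s, y) \<Rightarrow> \<bar>u s y - c\<bar>)) \<le>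
      norm ((1 + \<bar>c\<bar>) * indicator S q + indicator ({0<..<T} \<times> K) q *\<^sub>R (case q of (t, x) \<Rightarrow> u t x powr m))"
  proof (rule AE_I2)
    fix q :: "real \<times> 'a"
    obtain s y where q: "q = (s, y)" by (cases q)
    have "\<bar>u s y\<bar> \<le> 1 + u s y powr m"
    proof (cases "\<bar>u s y\<bar> \<le> 1")
      case True
      then show ?thesis using powr_ge_zero[of "u s y" m] by linarith
    next
      case False
      then have "\<bar>u s y\<bar> powr 1 \<le> \<bar>u s y\<bar> powr m" using m by (intro powr_mono) auto
      moreover have "u s y powr m = \<bar>u s y\<bar> powr m" by (auto simp: abs_if uminus_powr_eq)
      ultimately show ?thesis using False by simp
    qed
    then have "\<bar>u s y - c\<bar> \<le> 1 + \<bar>c\<bar> + u s y powr m" by linarith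
    then show "norm (indicator S q *\<^sub>R (case q of (s, y) \<Rightarrow> \<bar>u s y - c\<bar>)) \<le>
      norm ((1 + \<bar>c\<bar>) * indicator S q + indicator ({0<..<T} \<times> K) q *\<^sub>R (case q of (t, x) \<Rightarrow> u t x powr m))"
      using S(1) unfolding q by (auto simp: indicator_def)
  qed
qed

lemma LIMSEQ_dist_inverse_Suc:
  fixes X :: "nat \<Rightarrow> 'b::metric_space"
  assumes "\<And>n. dist (X n) l < inverse (real (Suc n))"
  shows "X \<longlonglongrightarrow> l"
proof -
  have "(\<lambda>n. dist (X n) l) \<longlonglongrightarrow> 0"
  proof (rule tendsto_sandwich[OF _ _ tendsto_const LIMSEQ_inverse_real_of_nat])
    show "\<forall>\<^sub>F n in sequentially. dist (X n) l \<le> inverse (real (Suc n))"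
      using assms less_imp_le by (intro always_eventually allI) blast
  qed simp
  then show ?thesis by (simp only: tendsto_dist_iff[symmetric])
qed

text \<open>
  At a Lebesgue point, in either of the two senses, the value is a limit of values at points where a
  predicate \<open>Q\<close> of full measure holds, at times \<open>s n \<ge> \<tau>\<close>. In the space-time sense the points are
  selected in balls about \<open>(\<tau> + r / 2, x0)\<close>; in the other sense all times are \<open>\<tau>\<close>.
\<close>

lemma lebesgue_point_sequence:
  fixes u :: "real \<Rightarrow> 'a::euclidean_space \<Rightarrow> real"
  assumes m: "1 < m" and sc: "\<And>T. 0 < T \<Longrightarrow> solution_class m T u0 u" and \<tau>: "0 < \<tau>"
    and leb: "lebesgue_point u \<tau> x0"
    and Q: "AE s in lborel. \<tau> \<le> s \<longrightarrow> (AE x in lborel. Q s x)" and Q\<tau>: "AE x in lborel. Q \<tau> x"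
  obtains s Y where "\<And>n. \<tau> \<le> s n" "\<And>n. Q (s n) (Y n)" "s \<longlonglongrightarrow> \<tau>" "Y \<longlonglongrightarrow> x0"
    "(\<lambda>n. u (s n) (Y n)) \<longlonglongrightarrow> precise_version u \<tau> x0"
proof -
  define c where "c = precise_version u \<tau> x0"
  have "\<exists>s y. \<tau> \<le> s \<and> Q s y \<and> \<bar>s - \<tau>\<bar> < \<delta> \<and> dist y x0 < \<delta> \<and> \<bar>u s y - c\<bar> < \<delta>" if \<delta>: "0 < \<delta>" for \<delta>
    using leb unfolding lebesgue_point_def c_def[symmetric]
  proof
    assume lim: "((\<lambda>r. ball_average (\<lambda>(s, y). \<bar>u s y - c\<bar>) (\<tau>, x0) r) \<longlongrightarrow> 0) (at_right 0)"
    have sub: "ball (\<tau>, x0) \<tau> \<subseteq> {0<..<2 * \<tau>} \<times> cball x0 \<tau>"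
    proof
      fix w assume "w \<in> ball (\<tau>, x0) \<tau>"
      then show "w \<in> {0<..<2 * \<tau>} \<times> cball x0 \<tau>"
        using dist_fst_le[of "(\<tau>, x0)" w] dist_snd_le[of "(\<tau>, x0)" w]
        by (cases w) (auto simp: dist_real_def abs_if split: if_splits)
    qed
    have "0 < 2 * \<tau>" using \<tau> by simp
    note int = solution_locally_integrable[OF m sc[OF this] sub _ compact_cball, of c]
    have P: "(\<integral>w. g w \<partial>lborel) \<le> (\<integral>w. h w \<partial>lborel)"
      if "integrable lborel g" "integrable lborel h"
        and le: "\<And>w. (\<tau> \<le> fst w \<longrightarrow> Q (fst w) (snd w)) \<Longrightarrow> g w \<le> h w" for g h :: "real \<times> 'a \<Rightarrow> real"
    proof (rule integral_mono_iterated_AE[OF that(1,2)])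
      show "AE s in lborel. AE x in lborel. g (s, x) \<le> h (s, x)"
        using Q
      proof eventually_elim
        case (elim s)
        then show ?case
        proof (cases "\<tau> \<le> s")
          case True
          with elim have "AE x in lborel. Q s x" by blast
          then show ?thesis by (rule eventually_mono) (use le in auto)
        qed (use le in auto)
      qed
    qed
    obtain r w where r: "0 < r" "r < \<delta>" and w: "w \<in> ball ((\<tau>, x0) + (r / 2) *\<^sub>R (1, 0)) (r / 2)"
      "w \<in> ball (\<tau>, x0) r" and Pw: "\<tau> \<le> fst w \<longrightarrow> Q (fst w) (snd w)"
      and fw: "(case w of (s, y) \<Rightarrow> \<bar>u s y - c\<bar>) < \<delta>"
      by (rule ball_average_select[OF _ \<tau> int lim, of "(1, 0)" "\<lambda>w. \<tau> \<le> fst w \<longrightarrow> Q (fst w) (snd w)" \<delta>, OF _ _ _ P \<delta>])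
         (auto simp: norm_prod_def)
    obtain s y where sy: "w = (s, y)" by (cases w)
    have "\<bar>s - (\<tau> + r / 2)\<bar> < r / 2"
      using w(1) dist_fst_le[of "(\<tau>, x0) + (r / 2) *\<^sub>R (1, 0)" w] unfolding sy
      by (simp add: dist_real_def abs_minus_commute)
    then have "\<tau> \<le> s" by (simp add: abs_if split: if_splits)
    moreover have "\<bar>s - \<tau>\<bar> < \<delta>" "dist y x0 < \<delta>"
      using w(2) r dist_fst_le[of "(\<tau>, x0)" w] dist_snd_le[of "(\<tau>, x0)" w] unfolding sy
      by (auto simp: dist_real_def abs_minus_commute dist_commute)
    ultimately show ?thesis using Pw fw unfolding sy by (intro exI[of _ s] exI[of _ y]) auto
  next
    assume lim: "((\<lambda>r. ball_average (\<lambda>y. \<bar>u \<tau> y - c\<bar>) x0 r) \<longlongrightarrow> 0) (at_right 0)"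
    have ui: "integrable lborel (u \<tau>)" using sc[of "\<tau> + 1"] \<tau> unfolding solution_class_def by auto
    have int: "set_integrable lborel (ball x0 1) (\<lambda>y. \<bar>u \<tau> y - c\<bar>)"
    proof (intro set_integrable_abs set_integral_diff(1))
      show "set_integrable lborel (ball x0 1) (u \<tau>)"
        unfolding set_integrable_def by (rule integrable_mult_indicator[OF _ ui]) simp
      show "set_integrable lborel (ball x0 1) (\<lambda>y. c)"
        using integrable_mult_left[OF integrable_indicator_bounded[of "ball x0 1"], of c]
        by (simp add: set_integrable_def)
    qed
    have P: "(\<integral>w. g w \<partial>lborel) \<le> (\<integral>w. h w \<partial>lborel)"
      if "integrable lborel g" "integrable lborel h" "\<And>w. Q \<tau> w \<Longrightarrow> g w \<le> h w" for g h :: "'a \<Rightarrow> real"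
      using that Q\<tau> by (intro integral_mono_AE) (auto elim: eventually_mono)
    obtain r w where "0 < r" "r < \<delta>" "w \<in> ball x0 r" "Q \<tau> w" "\<bar>u \<tau> w - c\<bar> < \<delta>"
      by (rule ball_average_select[OF _ zero_less_one int lim, of 0 "Q \<tau>" \<delta>, OF _ _ P \<delta>])
         (assumption | rule that | simp)+
    then show ?thesis using \<delta> by (intro exI[of _ \<tau>] exI[of _ w]) (auto simp: dist_commute)
  qed
  then have "\<exists>s y. \<tau> \<le> s \<and> Q s y \<and> \<bar>s - \<tau>\<bar> < inverse (real (Suc n)) \<and> dist y x0 < inverse (real (Suc n)) \<and>
      \<bar>u s y - c\<bar> < inverse (real (Suc n))" for n
    by (simp del: of_nat_Suc)
  then obtain s Y where sY: "\<And>n. \<tau> \<le> s n" "\<And>n. Q (s n) (Y n)" "\<And>n. \<bar>s n - \<tau>\<bar> < inverse (real (Suc n))"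
    "\<And>n. dist (Y n) x0 < inverse (real (Suc n))" "\<And>n. \<bar>u (s n) (Y n) - c\<bar> < inverse (real (Suc n))"
    by metis
  show thesis
  proof (rule that)
    show "\<tau> \<le> s n" "Q (s n) (Y n)" for n by (fact sY)+
    show "s \<longlonglongrightarrow> \<tau>" "Y \<longlonglongrightarrow> x0"
      by (rule LIMSEQ_dist_inverse_Suc, use sY(3,4) in \<open>simp add: dist_real_def del: of_nat_Suc\<close>)+
    show "(\<lambda>n. u (s n) (Y n)) \<longlonglongrightarrow> precise_version u \<tau> x0"
      using sY(5) unfolding c_def[symmetric]
      by (intro LIMSEQ_dist_inverse_Suc) (simp add: dist_real_def del: of_nat_Suc)
  qed
qed

lemma lebesgue_point_bound:
  fixes u :: "real \<Rightarrow> 'a::euclidean_space \<Rightarrow> real"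
  assumes G: "tame_kernel (G 0)" and m: "1 < m"
    and sc: "\<And>T. 0 < T \<Longrightarrow> solution_class m T u0 u" and \<tau>: "0 < \<tau>"
    and leb: "lebesgue_point u \<tau> x0"
    and K: "AE s in lborel. \<tau> \<le> s \<longrightarrow> (AE x in lborel. K * u s x powr m \<le> green_inv G (u s) x)"
      "AE x in lborel. K * u \<tau> x powr m \<le> green_inv G (u \<tau>) x"
    and M: "AE s in lborel. \<tau> \<le> s \<longrightarrow> (AE x in lborel. \<bar>u s x\<bar> \<le> M)" "AE x in lborel. \<bar>u \<tau> x\<bar> \<le> M"
  shows "K * precise_version u \<tau> x0 powr m \<le> green_inv G (u \<tau>) x0"
proof -
  define c where "c = precise_version u \<tau> x0"
  have int: "integrable lborel (u r)" and nonneg: "AE x in lborel. 0 \<le> u r x" if "0 \<le> r" for r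
    using sc[of "r + 1"] that unfolding solution_class_def by auto
  \<comment> \<open>The last conjunct does not depend on \<open>x\<close>; it provides the bound uniform along the sequence.\<close>
  define Q where "Q s x \<longleftrightarrow> K * u s x powr m \<le> green_inv G (u s) x \<and> 0 \<le> u s x \<and> (AE x in lborel. \<bar>u s x\<bar> \<le> M)" for s x
  have Q: "AE s in lborel. \<tau> \<le> s \<longrightarrow> (AE x in lborel. Q s x)"
    using K(1) M(1)
  proof eventually_elim
    case (elim s)
    show ?case
    proof
      assume s: "\<tau> \<le> s"
      then have "AE x in lborel. K * u s x powr m \<le> green_inv G (u s) x" using elim by blast
      moreover have "AE x in lborel. 0 \<le> u s x" using s \<tau> by (intro nonneg) simp
      ultimately show "AE x in lborel. Q s x"
        by eventually_elim (use elim s in \<open>simp add: Q_def\<close>)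
    qed
  qed
  have "AE x in lborel. 0 \<le> u \<tau> x" using \<tau> by (intro nonneg) simp
  with K(2) have Q\<tau>: "AE x in lborel. Q \<tau> x"
    by eventually_elim (use M(2) in \<open>simp add: Q_def\<close>)
  obtain s Y where s: "\<And>n. \<tau> \<le> s n" and QsY: "\<And>n. Q (s n) (Y n)" and lims: "s \<longlonglongrightarrow> \<tau>" "Y \<longlonglongrightarrow> x0"
    and limu: "(\<lambda>n. u (s n) (Y n)) \<longlonglongrightarrow> precise_version u \<tau> x0"
    by (rule lebesgue_point_sequence[OF m sc \<tau> leb Q Q\<tau>]) (assumption | rule that)+
  have s0: "0 \<le> s n" for n using s[of n] \<tau> by simp
  have \<tau>0: "0 \<le> \<tau>" using \<tau> by simp
  have "(\<lambda>n. green_inv G (u (s n)) (Y n)) \<longlonglongrightarrow> green_inv G (u \<tau>) x0"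
  proof (rule green_inv_tendsto[where G=G, OF G int[OF \<tau>0] M(2) int[OF s0] _ _ lims(2)])
    show "AE x in lborel. \<bar>u (s n) x\<bar> \<le> M" for n using QsY[of n] by (simp add: Q_def)
    show "(\<lambda>n. \<integral>x. \<bar>u (s n) x - u \<tau> x\<bar> \<partial>lborel) \<longlonglongrightarrow> 0"
      by (rule solution_L1_continuous[OF sc \<tau>0 lims(1) s0])
  qed
  moreover have "(\<lambda>n. K * u (s n) (Y n) powr m) \<longlonglongrightarrow> K * c powr m"
    using QsY m by (intro tendsto_mult tendsto_const tendsto_powr2[OF limu[folded c_def]]) (auto simp: Q_def)
  ultimately show ?thesis
    unfolding c_def[symmetric] using QsY by (intro LIMSEQ_le) (auto simp: Q_def)
qed

section \<open>Generic times\<close>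

text \<open>
  A positive time from which the dual identity and the decay of the supremum start, in each case up
  to almost every later time, and at which the solution is bounded.
\<close>

definition good_time ::
  "real \<Rightarrow> ('a::euclidean_space \<Rightarrow> 'a \<Rightarrow> real) \<Rightarrow> real \<Rightarrow> (real \<Rightarrow> 'a \<Rightarrow> real) \<Rightarrow> real \<Rightarrow> bool" where
  "good_time b G m u s \<longleftrightarrow>
    0 < s \<and> (AE t in lborel. s \<le> t \<longrightarrow> dual_identity b G m u s t) \<and>
    (AE t in lborel. s \<le> t \<longrightarrow> lnorm \<infinity> (u t) \<le> lnorm \<infinity> (u s)) \<and> lnorm \<infinity> (u s) < \<infinity>"

lemma AE_good_time:
  fixes u :: "real \<Rightarrow> 'a::euclidean_space \<Rightarrow> real"
  assumes u0: "initial_datum u0" and u: "dual_solution b G m u0 u"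
    and decay: "Lp_decay (dual_solution b G m)"
  shows "AE s in lborel. 0 < s \<longrightarrow> good_time b G m u s"
proof -
  have "AE s in lborel. \<forall>n. AE t in lborel. 0 < s \<and> s \<le> t \<and> t \<le> real (Suc n) \<longrightarrow> dual_identity b G m u s t"
    unfolding AE_all_countable
  proof
    fix n
    have "AE (s, t) in lborel. 0 < s \<and> s \<le> t \<and> t \<le> real (Suc n) \<longrightarrow> dual_identity b G m u s t"
      using u[unfolded dual_solution_def, rule_format, of "real (Suc n)"] by simp
    then show "AE s in lborel. AE t in lborel. 0 < s \<and> s \<le> t \<and> t \<le> real (Suc n) \<longrightarrow> dual_identity b G m u s t"
      by (rule AE_lborel_pair)
  qed
  then have 1: "AE s in lborel. 0 < s \<longrightarrow> (AE t in lborel. s \<le> t \<longrightarrow> dual_identity b G m u s t)"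
  proof (rule eventually_mono, intro impI)
    fix s :: real
    assume "\<forall>n. AE t in lborel. 0 < s \<and> s \<le> t \<and> t \<le> real (Suc n) \<longrightarrow> dual_identity b G m u s t" and s: "0 < s"
    then have "AE t in lborel. \<forall>n. 0 < s \<and> s \<le> t \<and> t \<le> real (Suc n) \<longrightarrow> dual_identity b G m u s t"
      by (simp only: AE_all_countable) blast
    then show "AE t in lborel. s \<le> t \<longrightarrow> dual_identity b G m u s t"
    proof (rule eventually_mono, intro impI)
      fix t assume *: "\<forall>n. 0 < s \<and> s \<le> t \<and> t \<le> real (Suc n) \<longrightarrow> dual_identity b G m u s t" "s \<le> t"
      obtain n :: nat where "t \<le> real n" using real_arch_simple by blast
      then have "t \<le> real (Suc n)" by simp
      with * s show "dual_identity b G m u s t" by blast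
    qed
  qed
  have d: "AE (s, t) in lborel. 0 \<le> s \<and> s \<le> t \<longrightarrow> lnorm \<infinity> (u t) \<le> lnorm \<infinity> (u s)"
    "AE s in lborel. 0 \<le> s \<longrightarrow> lnorm \<infinity> (u s) \<le> lnorm \<infinity> (u 0)"
    using decay u0 u unfolding Lp_decay_def by auto
  have "lnorm \<infinity> (u 0) < \<infinity>"
  proof -
    have sc: "solution_class m 1 u0 u" using u by (simp add: dual_solution_def)
    then have "AE x in lborel. u 0 x = u0 x" "integrable lborel (u 0)" by (auto simp: solution_class_def)
    moreover have "AE x in lborel. \<bar>u0 x\<bar> \<le> enn2real (lnorm \<infinity> u0)"
      using u0 by (intro lnorm_infinity_AE) (simp add: initial_datum_def)
    ultimately have "lnorm \<infinity> (u 0) \<le> ennreal (enn2real (lnorm \<infinity> u0))"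
      by (intro lnorm_infinity_le) (auto elim: eventually_elim2)
    then show ?thesis by (rule le_less_trans) simp
  qed
  with d(2) have 3: "AE s in lborel. 0 < s \<longrightarrow> lnorm \<infinity> (u s) < \<infinity>"
    by (auto elim!: eventually_mono)
  show ?thesis using 1 AE_lborel_pair[OF d(1)] 3
    by eventually_elim (auto simp: good_time_def)
qed

lemma good_time_bound:
  fixes u :: "real \<Rightarrow> 'a::euclidean_space \<Rightarrow> real"
  assumes G: "tame_kernel (G 0)" and m: "1 < m"
    and cp: "comparison_principle (dual_solution b G m)" and u0: "initial_datum u0"
    and u: "dual_solution b G m u0 u" and good: "good_time b G m u s" and b: "0 \<le> b"
    and L: "b * enn2real (lnorm \<infinity> (u s)) powr (m - 1) \<le> L" and h: "0 < h"
  shows "AE x in lborel. (LINT t:{s..s + h}|lborel. exp (- L * (t - s))) *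
      (1 + h / s) powr - (m / (m - 1)) * u s x powr m \<le> green_inv G (u s) x"
proof -
  define M where "M = enn2real (lnorm \<infinity> (u s))"
  have s: "0 < s" and fin: "lnorm \<infinity> (u s) < \<infinity>" using good by (auto simp: good_time_def)
  have L0: "0 \<le> L" using b L by (meson mult_nonneg_nonneg order_trans powr_ge_zero)
  have bound: "AE t in lborel. s \<le> t \<longrightarrow> (AE x in lborel. \<bar>u t x\<bar> \<le> M)"
  proof -
    have "AE t in lborel. s \<le> t \<longrightarrow> lnorm \<infinity> (u t) \<le> lnorm \<infinity> (u s)"
      using good by (simp add: good_time_def)
    then show ?thesis
    proof (rule eventually_mono, intro impI)
      fix t assume "s \<le> t \<longrightarrow> lnorm \<infinity> (u t) \<le> lnorm \<infinity> (u s)" "s \<le> t"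
      then have le: "lnorm \<infinity> (u t) \<le> lnorm \<infinity> (u s)" by blast
      then have "AE x in lborel. \<bar>u t x\<bar> \<le> enn2real (lnorm \<infinity> (u t))"
        using fin by (intro lnorm_infinity_AE) (rule le_less_trans)
      moreover have "enn2real (lnorm \<infinity> (u t)) \<le> M"
        unfolding M_def using le fin by (intro enn2real_mono) auto
      ultimately show "AE x in lborel. \<bar>u t x\<bar> \<le> M" by (auto elim: eventually_mono)
    qed
  qed
  have reaction: "AE t in lborel. s \<le> t \<longrightarrow> (AE x in lborel. b * u t x powr m \<le> L * u t x)"
    using bound
  proof (rule eventually_mono, intro impI)
    fix t assume *: "s \<le> t \<longrightarrow> (AE x in lborel. \<bar>u t x\<bar> \<le> M)" "s \<le> t"
    then have "AE x in lborel. \<bar>u t x\<bar> \<le> M" by blast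
    moreover have "AE x in lborel. 0 \<le> u t x"
      using u[unfolded dual_solution_def, rule_format, of "t + 1"] s *(2) unfolding solution_class_def by auto
    ultimately show "AE x in lborel. b * u t x powr m \<le> L * u t x"
    proof eventually_elim
      case (elim x)
      have "u t x powr m = u t x powr (m - 1) * u t x"
        using elim powr_mult_base[of "u t x" "m - 1"] by (simp add: mult.commute)
      moreover have "b * u t x powr (m - 1) \<le> b * M powr (m - 1)"
        using elim m b by (intro mult_left_mono powr_mono2) auto
      ultimately show ?case
        using L elim by (simp flip: mult.assoc add: M_def mult_right_mono)
    qed
  qed
  show ?thesis
  proof (rule fundamental_pointwise_bound[OF G m cp u0 u L0 s h _ bound _ reaction])
    show "AE t in lborel. s \<le> t \<longrightarrow> dual_identity b G m u s t" using good by (simp add: good_time_def)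
    show "AE x in lborel. \<bar>u s x\<bar> \<le> M" unfolding M_def by (rule lnorm_infinity_AE[OF fin])
  qed
qed

text \<open>
  The bound at Lebesgue points, for a constant \<open>K\<close> that is admissible at all later times; the
  length \<open>h s\<close> of the time interval may depend on the time \<open>s\<close> at which it starts.
\<close>

lemma good_time_lebesgue_point_bound:
  fixes u :: "real \<Rightarrow> 'a::euclidean_space \<Rightarrow> real"
  assumes G: "tame_kernel (G 0)" and m: "1 < m"
    and cp: "comparison_principle (dual_solution b G m)" and u0: "initial_datum u0"
    and u: "dual_solution b G m u0 u" and decay: "Lp_decay (dual_solution b G m)"
    and good: "good_time b G m u \<tau>" and b: "0 \<le> b"
    and L: "b * enn2real (lnorm \<infinity> (u \<tau>)) powr (m - 1) \<le> L"
    and h: "\<And>s. \<tau> \<le> s \<Longrightarrow> 0 < h s"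
    and K: "\<And>s. \<tau> \<le> s \<Longrightarrow> K \<le> (LINT t:{s..s + h s}|lborel. exp (- L * (t - s))) *
      (1 + h s / s) powr - (m / (m - 1))"
    and leb: "lebesgue_point u \<tau> x0"
  shows "K * precise_version u \<tau> x0 powr m \<le> green_inv G (u \<tau>) x0"
proof -
  define M where "M = enn2real (lnorm \<infinity> (u \<tau>))"
  have \<tau>: "0 < \<tau>" and fin: "lnorm \<infinity> (u \<tau>) < \<infinity>" using good by (auto simp: good_time_def)
  have main: "(AE x in lborel. K * u s x powr m \<le> green_inv G (u s) x) \<and> (AE x in lborel. \<bar>u s x\<bar> \<le> M)"
    if s: "\<tau> \<le> s" and gs: "good_time b G m u s" and le: "lnorm \<infinity> (u s) \<le> lnorm \<infinity> (u \<tau>)" for s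
  proof
    have Ms: "enn2real (lnorm \<infinity> (u s)) \<le> M" unfolding M_def using le fin by (intro enn2real_mono) auto
    then have "b * enn2real (lnorm \<infinity> (u s)) powr (m - 1) \<le> b * M powr (m - 1)"
      using m b by (intro mult_left_mono powr_mono2) auto
    then have "b * enn2real (lnorm \<infinity> (u s)) powr (m - 1) \<le> L" using L by (simp add: M_def)
    from good_time_bound[OF G m cp u0 u gs b this h[OF s]]
    show "AE x in lborel. K * u s x powr m \<le> green_inv G (u s) x"
    proof (rule eventually_mono)
      fix x
      assume "(LINT t:{s..s + h s}|lborel. exp (- L * (t - s))) *
        (1 + h s / s) powr - (m / (m - 1)) * u s x powr m \<le> green_inv G (u s) x"
      then show "K * u s x powr m \<le> green_inv G (u s) x"
        using mult_right_mono[OF K[OF s], of "u s x powr m"] by simp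
    qed
    have "lnorm \<infinity> (u s) < \<infinity>" using gs by (simp add: good_time_def)
    from lnorm_infinity_AE[OF this] show "AE x in lborel. \<bar>u s x\<bar> \<le> M"
      by (rule eventually_mono) (use Ms in simp)
  qed
  have "AE s in lborel. \<tau> \<le> s \<longrightarrow> lnorm \<infinity> (u s) \<le> lnorm \<infinity> (u \<tau>)"
    using good by (simp add: good_time_def)
  with AE_good_time[OF u0 u decay]
  have ae: "AE s in lborel. \<tau> \<le> s \<longrightarrow>
      (AE x in lborel. K * u s x powr m \<le> green_inv G (u s) x) \<and> (AE x in lborel. \<bar>u s x\<bar> \<le> M)"
    by eventually_elim (use main \<tau> in auto)
  have sc: "solution_class m T u0 u" if "0 < T" for T using u that by (simp add: dual_solution_def)
  show ?thesis
  proof (rule lebesgue_point_bound[where G=G, OF G m sc \<tau> leb])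
    show "AE s in lborel. \<tau> \<le> s \<longrightarrow> (AE x in lborel. K * u s x powr m \<le> green_inv G (u s) x)"
      using ae by (rule eventually_mono) blast
    show "AE s in lborel. \<tau> \<le> s \<longrightarrow> (AE x in lborel. \<bar>u s x\<bar> \<le> M)"
      using ae by (rule eventually_mono) blast
  qed (use main[OF order_refl good order_refl] in blast)+
qed

lemma integral_exponential_weight:
  fixes L h s :: real
  assumes "0 < L" "0 \<le> h"
  shows "(LINT t:{s..s + h}|lborel. exp (- L * (t - s))) = (1 - exp (- L * h)) / L"
proof -
  have "(\<integral>t. exp (- L * (t - s)) * indicator {s..s + h} t \<partial>lborel) =
      - exp (- L * (s + h - s)) / L - - exp (- L * (s - s)) / L"
    using assms by (intro integral_FTC_Icc_real) (auto intro!: derivative_eq_intros continuous_intros)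
  then show ?thesis using assms
    by (simp add: set_lebesgue_integral_def mult.commute diff_divide_distrib)
qed

theorem theorem4p6:
  fixes D :: "('a::euclidean_space \<Rightarrow> real) set"
    and A :: "('a \<Rightarrow> real) \<Rightarrow> 'a \<Rightarrow> real"
    and m :: real
    and u0 :: "'a \<Rightarrow> real"
    and u :: "real \<Rightarrow> 'a \<Rightarrow> real"
  assumes dim: "3 \<le> DIM('a)"
    and m: "1 < m"
    and u0: "initial_datum u0"
    and A: "admissible_operator D A"
  shows
    "(\<forall>G. green_function D A G \<and> (green_G1 G \<or> green_G1' G \<or> green_G2 G) \<and>
        comparison_principle (weak_dual_solution G m) \<and> Lp_decay (weak_dual_solution G m) \<and>
        weak_dual_solution G m u0 u \<longrightarrow>
        (AE \<tau> in lborel. 0 < \<tau> \<longrightarrow>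
          (\<forall>x0. lebesgue_point u \<tau> x0 \<longrightarrow>
            precise_version u \<tau> x0 powr m
              \<le> 2 powr (m / (m - 1)) * (1 / \<tau>) * (\<integral>x. u \<tau> x * G x0 x \<partial>lborel)))) \<and>
     (\<forall>G. green_function D (\<lambda>f x. f x + A f x) G \<and> green_G3 G \<and>
        comparison_principle (weak_dual_solution_resolvent G m) \<and>
        Lp_decay (weak_dual_solution_resolvent G m) \<and>
        weak_dual_solution_resolvent G m u0 u \<longrightarrow>
        (AE \<tau> in lborel. 0 < \<tau> \<longrightarrow>
          (\<forall>\<mu>. \<mu> = enn2real (lnorm \<infinity> (u \<tau>)) powr (m - 1) \<and> \<mu> > 1 / ((m - 1) * \<tau>) \<longrightarrow>
            (\<forall>x0. lebesgue_point u \<tau> x0 \<longrightarrow>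
              precise_version u \<tau> x0 powr m
                \<le> 2 * (1 + m) powr (m / (m - 1)) * \<mu> * (\<integral>x. u \<tau> x * G x0 x \<partial>lborel)))))"
proof (intro conjI allI impI; elim conjE)
  fix G :: "'a \<Rightarrow> 'a \<Rightarrow> real"
  assume green: "green_function D A G" and cond: "green_G1 G \<or> green_G1' G \<or> green_G2 G"
    and cp: "comparison_principle (weak_dual_solution G m)" and decay: "Lp_decay (weak_dual_solution G m)"
    and u: "weak_dual_solution G m u0 u"
  have G: "tame_kernel (G 0)" using green_function_tame[OF green] cond by blast
  note cp = cp[unfolded weak_dual_solution_eq] and decay = decay[unfolded weak_dual_solution_eq]
    and u = u[unfolded weak_dual_solution_eq]
  show "AE \<tau> in lborel. 0 < \<tau> \<longrightarrow>
          (\<forall>x0. lebesgue_point u \<tau> x0 \<longrightarrow>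
            precise_version u \<tau> x0 powr m
              \<le> 2 powr (m / (m - 1)) * (1 / \<tau>) * (\<integral>x. u \<tau> x * G x0 x \<partial>lborel))"
    using AE_good_time[OF u0 u decay]
  proof (eventually_elim, intro allI impI)
    fix \<tau> :: real and x0 assume "0 < \<tau> \<longrightarrow> good_time 0 G m u \<tau>" and \<tau>: "0 < \<tau>" and leb: "lebesgue_point u \<tau> x0"
    then have good: "good_time 0 G m u \<tau>" by blast
    have "integrable lborel (u \<tau>)"
      using u[unfolded dual_solution_def, rule_format, of "\<tau> + 1"] \<tau> unfolding solution_class_def by auto
    then have [measurable]: "u \<tau> \<in> borel_measurable borel" by auto
    have "\<tau> * 2 powr - (m / (m - 1)) * precise_version u \<tau> x0 powr m \<le> green_inv G (u \<tau>) x0"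
    proof (rule good_time_lebesgue_point_bound[OF G m cp u0 u decay good order_refl, of 0 "\<lambda>s. s"])
      fix s assume s: "\<tau> \<le> s"
      then show "0 < s" using \<tau> by simp
      have "(LINT t:{s..s + s}|lborel. exp (- 0 * (t - s))) = s"
        using s \<tau> by (simp add: set_lebesgue_integral_def)
      then show "\<tau> * 2 powr - (m / (m - 1)) \<le>
          (LINT t:{s..s + s}|lborel. exp (- 0 * (t - s))) * (1 + s / s) powr - (m / (m - 1))"
        using s \<tau> by simp
    qed (use leb in simp_all)
    also have "green_inv G (u \<tau>) x0 = (\<integral>x. u \<tau> x * G x0 x \<partial>lborel)"
      by (rule green_function_integral[OF green, symmetric]) measurable
    finally show "precise_version u \<tau> x0 powr m
        \<le> 2 powr (m / (m - 1)) * (1 / \<tau>) * (\<integral>x. u \<tau> x * G x0 x \<partial>lborel)"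
      using \<tau> by (simp add: powr_minus field_simps)
  qed
next
  fix G :: "'a \<Rightarrow> 'a \<Rightarrow> real"
  assume green: "green_function D (\<lambda>f x. f x + A f x) G" and cond: "green_G3 G"
    and cp: "comparison_principle (weak_dual_solution_resolvent G m)"
    and decay: "Lp_decay (weak_dual_solution_resolvent G m)"
    and u: "weak_dual_solution_resolvent G m u0 u"
  have G: "tame_kernel (G 0)" using green_function_tame[OF green] cond by blast
  note cp = cp[unfolded weak_dual_solution_resolvent_eq]
    and decay = decay[unfolded weak_dual_solution_resolvent_eq]
    and u = u[unfolded weak_dual_solution_resolvent_eq]
  show "AE \<tau> in lborel. 0 < \<tau> \<longrightarrow>
          (\<forall>\<mu>. \<mu> = enn2real (lnorm \<infinity> (u \<tau>)) powr (m - 1) \<and> \<mu> > 1 / ((m - 1) * \<tau>) \<longrightarrow>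
            (\<forall>x0. lebesgue_point u \<tau> x0 \<longrightarrow>
              precise_version u \<tau> x0 powr m
                \<le> 2 * (1 + m) powr (m / (m - 1)) * \<mu> * (\<integral>x. u \<tau> x * G x0 x \<partial>lborel)))"
    using AE_good_time[OF u0 u decay]
  proof (eventually_elim, intro allI impI, elim conjE)
    fix \<tau> \<mu> :: real and x0 assume "0 < \<tau> \<longrightarrow> good_time 1 G m u \<tau>" and \<tau>: "0 < \<tau>"
      and \<mu>_eq: "\<mu> = enn2real (lnorm \<infinity> (u \<tau>)) powr (m - 1)" and \<mu>: "1 / ((m - 1) * \<tau>) < \<mu>"
      and leb: "lebesgue_point u \<tau> x0"
    then have good: "good_time 1 G m u \<tau>" by blast
    have \<mu>0: "0 < \<mu>" using \<mu> m \<tau> by (meson diff_gt_0_iff_gt divide_pos_pos less_trans mult_pos_pos zero_less_one)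
    have "integrable lborel (u \<tau>)"
      using u[unfolded dual_solution_def, rule_format, of "\<tau> + 1"] \<tau> unfolding solution_class_def by auto
    then have [measurable]: "u \<tau> \<in> borel_measurable borel" by auto
    have "1 / (2 * \<mu>) * (1 + m) powr - (m / (m - 1)) * precise_version u \<tau> x0 powr m \<le> green_inv G (u \<tau>) x0"
    proof (rule good_time_lebesgue_point_bound[OF G m cp u0 u decay good zero_le_one, of \<mu> "\<lambda>_. 1 / \<mu>"])
      fix s assume s: "\<tau> \<le> s"
      \<comment> \<open>At least half of the mass of the weight \<open>exp (- \<mu> t)\<close> lies in \<open>[0, 1 / \<mu>]\<close>.\<close>
      have "(2::real) \<le> exp 1" using exp_ge_add_one_self[of 1] by simp
      then have "exp (- 1 :: real) \<le> 1 / 2" by (simp add: exp_minus field_simps)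
      then have "1 / (2 * \<mu>) \<le> (1 - exp (- \<mu> * (1 / \<mu>))) / \<mu>" using \<mu>0 by (simp add: field_simps)
      then have W: "1 / (2 * \<mu>) \<le> (LINT t:{s..s + 1 / \<mu>}|lborel. exp (- \<mu> * (t - s)))"
        using integral_exponential_weight[OF \<mu>0, of "1 / \<mu>" s] \<mu>0 by simp
      have "1 / \<mu> / s \<le> 1 / \<mu> / \<tau>" using s \<tau> \<mu>0 by (intro divide_left_mono) auto
      also have "\<dots> \<le> m - 1" using \<mu> \<mu>0 m \<tau> by (simp add: field_simps)
      finally have "1 + 1 / \<mu> / s \<le> 1 + m" by simp
      moreover have "0 < 1 + 1 / \<mu> / s" using s \<tau> \<mu>0 by (simp add: add_pos_pos)
      ultimately have "(1 + m) powr - (m / (m - 1)) \<le> (1 + 1 / \<mu> / s) powr - (m / (m - 1))"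
        using m by (intro powr_mono2') auto
      moreover have "0 \<le> 1 / (2 * \<mu>)" using \<mu>0 by simp
      ultimately show "1 / (2 * \<mu>) * (1 + m) powr - (m / (m - 1)) \<le>
          (LINT t:{s..s + 1 / \<mu>}|lborel. exp (- \<mu> * (t - s))) * (1 + 1 / \<mu> / s) powr - (m / (m - 1))"
        using W by (intro mult_mono W order_trans[OF _ W]) auto
    qed (use leb \<mu>0 \<mu>_eq in simp_all)
    also have "green_inv G (u \<tau>) x0 = (\<integral>x. u \<tau> x * G x0 x \<partial>lborel)"
      by (rule green_function_integral[OF green, symmetric]) measurable
    finally show "precise_version u \<tau> x0 powr m
        \<le> 2 * (1 + m) powr (m / (m - 1)) * \<mu> * (\<integral>x. u \<tau> x * G x0 x \<partial>lborel)"
      using \<mu>0 m by (simp add: powr_minus field_simps)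
  qed
qed

end
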